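(* The set of vectors $\{\widetilde\xi_I\}_{I\in\mathcal I_n}$ forms a basis of $\mathcal V=\widehat V_{w_1}\widetilde\otimes\cdots\widetilde\otimes\widehat V_{w_n}$.
   Context: Notation. $q,p\in\mathbb C^\times$ generic, $|q|,|p|<1$; $(x;p)_\infty=\prod_{n\ge0}(1-xp^n)$, $\Theta_p(z)=(z;p)_\infty(p/z;p)_\infty(p;p)_\infty$, $\theta(z)=-z^{-1/2}\Theta_p(z)$. $\mathbb F$: field of meromorphic functions of the dynamical variables $P_{\epsilon_1},\dots,P_{\epsilon_N}$; $\Pi^*_{j,k}=q^{2(P_{\epsilon_j}-P_{\epsilon_k})}$. The matrix $\widetilde R(z,\Pi^* )=\sum\widetilde R(z,\Pi^* )_{i\mu}^{j\nu}E_{ij}\otimes E_{\mu\nu}$ is $\widetilde R(z,\Pi^* )=\sum_j\theta(q^2z)E_{jj}\otimes E_{jj}+\sum_{j<k}\Big(\frac{\theta(q^2\Pi^*_{j,k})\theta(q^{-2}\Pi^*_{j,k})\theta(z)}{\theta(\Pi^*_{j,k})^2}E_{jj}\otimes E_{kk}+\theta(z)E_{kk}\otimes E_{jj}+\frac{\theta(q^2)\theta(z\Pi^*_{j,k})}{\theta(\Pi^*_{j,k})}E_{jk}\otimes E_{kj}+\frac{\theta(q^2)\theta(z/\Pi^*_{j,k})}{\theta(1/\Pi^*_{j,k})}E_{kj}\otimes E_{jk}\Big)$. Tensor product of vector representations. Let $\widehat V=\bigoplus_{\mu=1}^N\mathbb Fv_\mu$, $w_1,\dots,w_n\in\mathbb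 C^\times$ generic, and $\mathcal V=\widehat V_{w_1}\widetilde\otimes\cdots\widetilde\otimes\widehat V_{w_n}$, the $\mathbb F$-vector space with basis $v_{\boldsymbol\mu}=v_{\mu_1}\widetilde\otimes\cdots\widetilde\otimes v_{\mu_n}$, $\boldsymbol\mu\in[1,N]^n$. Write $\widetilde R^{(0n)}(z/w_n,\Pi^*q^{2\sum_{j=1}^{n-1}h^{(j)}})\cdots\widetilde R^{(02)}(z/w_2,\Pi^*q^{2h^{(1)}})\widetilde R^{(01)}(z/w_1,\Pi^* )=\sum_{k,l}E_{kl}\otimes T_{kl}(z;\Pi^* )$, where $0$ labels an auxiliary copy of $\mathbb C^N$ and $q^{2h^{(i)}}$ multiplies $\Pi^*_{j,k}$ by $q^{2(\delta_{\beta j}-\delta_{\beta k})}$ on vectors with $v_\beta$ in the $i$-th tensor factor. The $L$-operators act by $L^+_{kl}(z)(f(P)v_{\boldsymbol\alpha})=f(P+\epsilon_l)\,T_{kl}(z;\Pi^* )v_{\boldsymbol\alpha}$, where $f(P+\epsilon_l)$ means $P_{\epsilon_i}\mapsto P_{\epsilon_i}+\delta_{il}$ (so $\Pi^*_{i,j}\mapsto\Pi^*_{i,j}q^{2(\delta_{li}-\delta_{lj})}$). Put $\zeta=v_{(1,\dots,1)}$. $\mathcal I_n$: set of all ordered partitions $I=(I_1,\dots,I_N)$ of $[1,n]=\{1,\dots,n\}$ into disjoint (possibly empty) subsets. For $S=\{i_1<\dots<i_r\}$ put $L^+_{kl}(w_S)=L^+_{kl}(w_{i_r})\cdots L^+_{kl}(w_{i_1})$.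 Define $\widetilde\xi_I=L^+_{N-1,N}(w_{I_N})L^+_{N-2,N-1}(w_{I_{N-1}\cup I_N})\cdots L^+_{12}(w_{I_2\cup\cdots\cup I_N})\cdot\zeta$. *)

theory Defs
  imports
    "HOL-Complex_Analysis.Complex_Analysis"
    "HOL-Library.Function_Algebras"
    "HOL-Library.FuncSet"
    "HOL-Library.Disjoint_Sets"
begin

section \<open>The field of meromorphic functions on \<open>\<complex>\<^sup>N\<close>\<close>

definition holo_on :: "(complex^'n::finite \<Rightarrow> complex) \<Rightarrow> (complex^'n) set \<Rightarrow> bool" where
  "holo_on f U \<longleftrightarrow>
     (\<forall>x\<in>U. \<exists>D. (f has_derivative D) (at x) \<and> (\<forall>c v. D (c *s v) = c * D v))"

text \<open>
  Locally a quotient \<open>g / h\<close> of holomorphic functions, where \<open>h\<close> vanishes on no nonempty open set.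
  The values on the zero set of \<open>h\<close> are unconstrained; the quotient type below
  identifies meromorphic functions that agree on a dense open set.
\<close>

definition merom :: "(complex^'n::finite \<Rightarrow> complex) \<Rightarrow> bool" where
  "merom f \<longleftrightarrow>
     (\<forall>a. \<exists>U g h. open U \<and> a \<in> U \<and> holo_on g U \<and> holo_on h U \<and>
        interior {x\<in>U. h x = 0} = {} \<and> (\<forall>x\<in>U. h x \<noteq> 0 \<longrightarrow> f x = g x / h x))"

definition agree :: "('a::topological_space \<Rightarrow> 'b) \<Rightarrow> ('a \<Rightarrow> 'b) \<Rightarrow> bool" where
  "agree f g \<longleftrightarrow> (\<exists>D. open D \<and> closure D = UNIV \<and> (\<forall>x\<in>D. f x = g x))"

lemma agree_refl: "agree f f"
  unfolding agree_def by (rule exI[of _ UNIV]) auto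

lemma agree_sym: "agree f g \<Longrightarrow> agree g f"
  unfolding agree_def by metis

lemma dense_open_Int:
  fixes D E :: "'a::topological_space set"
  assumes "open D" "open E" "closure D = UNIV" "closure E = UNIV"
  shows "closure (D \<inter> E) = UNIV"
  using open_Int_closure_subset[OF assms(1), of E] assms closure_closure closure_mono
  by (metis Int_UNIV_right top.extremum_uniqueI)

lemma agree_comb:
  assumes "agree f f'" "agree g g'"
  shows "agree (\<lambda>x. F (f x) (g x)) (\<lambda>x. F (f' x) (g' x))"
proof -
  obtain D where D: "open D" "closure D = UNIV" "\<forall>x\<in>D. f x = f' x"
    using assms(1) unfolding agree_def by blast
  obtain E where E: "open E" "closure E = UNIV" "\<forall>x\<in>E. g x = g' x"
    using assms(2) unfolding agree_def by blast
  show ?thesis unfolding agree_def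
    using D E dense_open_Int[OF D(1) E(1) D(2) E(2)]
    by (intro exI[of _ "D \<inter> E"]) auto
qed

lemma agree_trans:
  assumes "agree f g" "agree g h" shows "agree f h"
proof -
  obtain D where D: "open D" "closure D = UNIV" "\<forall>x\<in>D. f x = g x"
    using assms(1) unfolding agree_def by blast
  obtain E where E: "open E" "closure E = UNIV" "\<forall>x\<in>E. g x = h x"
    using assms(2) unfolding agree_def by blast
  show ?thesis unfolding agree_def
    using D E dense_open_Int[OF D(1) E(1) D(2) E(2)]
    by (intro exI[of _ "D \<inter> E"]) auto
qed

lemma holo_on_subset: "holo_on f U \<Longrightarrow> V \<subseteq> U \<Longrightarrow> holo_on f V"
  unfolding holo_on_def by blast

lemma holo_on_const: "holo_on (\<lambda>x. c) U"
  unfolding holo_on_def by (auto intro!: exI[of _ "\<lambda>_. 0"])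

lemma holo_on_add:
  assumes "holo_on f U" "holo_on g U" shows "holo_on (\<lambda>x. f x + g x) U"
  unfolding holo_on_def
proof
  fix x assume "x \<in> U"
  then obtain D E where D: "(f has_derivative D) (at x)" "\<forall>c v. D (c *s v) = c * D v"
    and E: "(g has_derivative E) (at x)" "\<forall>c v. E (c *s v) = c * E v"
    using assms unfolding holo_on_def by meson
  show "\<exists>D. ((\<lambda>x. f x + g x) has_derivative D) (at x) \<and> (\<forall>c v. D (c *s v) = c * D v)"
    using has_derivative_add[OF D(1) E(1)] D(2) E(2)
    by (intro exI[of _ "\<lambda>v. D v + E v"]) (auto simp: algebra_simps)
qed

lemma holo_on_mult:
  assumes "holo_on f U" "holo_on g U" shows "holo_on (\<lambda>x. f x * g x) U"
  unfolding holo_on_def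
proof
  fix x assume "x \<in> U"
  then obtain D E where D: "(f has_derivative D) (at x)" "\<forall>c v. D (c *s v) = c * D v"
    and E: "(g has_derivative E) (at x)" "\<forall>c v. E (c *s v) = c * E v"
    using assms unfolding holo_on_def by meson
  show "\<exists>D. ((\<lambda>x. f x * g x) has_derivative D) (at x) \<and> (\<forall>c v. D (c *s v) = c * D v)"
    using has_derivative_mult[OF D(1) E(1)] D(2) E(2)
    by (intro exI[of _ "\<lambda>v. f x * E v + D v * g x"]) (auto simp: algebra_simps)
qed

lemma holo_on_shift:
  assumes "holo_on f U" shows "holo_on (\<lambda>x. f (x + c)) ((\<lambda>x. x - c) ` U)"
  unfolding holo_on_def
proof
  fix x assume "x \<in> (\<lambda>x. x - c) ` U"
  then have "x + c \<in> U" by auto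
  then obtain D where D: "(f has_derivative D) (at (x + c))" "\<forall>c v. D (c *s v) = c * D v"
    using assms unfolding holo_on_def by meson
  have "((\<lambda>x. x + c) has_derivative (\<lambda>v. v)) (at x)"
    by (auto intro!: derivative_eq_intros)
  from has_derivative_compose[OF this D(1)]
  show "\<exists>D. ((\<lambda>x. f (x + c)) has_derivative D) (at x) \<and> (\<forall>c v. D (c *s v) = c * D v)"
    using D(2) by blast
qed

lemma holo_on_imp_continuous_on: "holo_on f U \<Longrightarrow> continuous_on U f"
  unfolding holo_on_def
  by (meson continuous_at_imp_continuous_on has_derivative_continuous)

lemma interior_zeros_mult:
  fixes g h :: "complex^'n::finite \<Rightarrow> complex"
  assumes "open U" "continuous_on U g"
    and "interior {x\<in>U. g x = 0} = {}" "interior {x\<in>U. h x = 0} = {}"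
  shows "interior {x\<in>U. g x * h x = 0} = {}"
proof (rule ccontr)
  assume ne: "interior {x\<in>U. g x * h x = 0} \<noteq> {}"
  define V where "V = interior {x\<in>U. g x * h x = 0}"
  have V: "open V" "V \<noteq> {}" "V \<subseteq> U" "\<forall>x\<in>V. g x * h x = 0"
    using ne interior_subset[of "{x\<in>U. g x * h x = 0}"] unfolding V_def by auto
  define W where "W = V \<inter> g -` (- {0})"
  have W: "open W" unfolding W_def
    by (rule continuous_open_preimage) (use V continuous_on_subset[OF assms(2)] in auto)
  have "W \<subseteq> {x\<in>U. h x = 0}" using V unfolding W_def by auto
  then have "W = {}" using W assms(4) interior_maximal by blast
  then have "V \<subseteq> {x\<in>U. g x = 0}" using V unfolding W_def by auto
  then show False using V(1,2) assms(3) interior_maximal by blast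
qed

lemma merom_const: "merom (\<lambda>_. c)"
  unfolding merom_def
  by (intro allI, rule exI[of _ UNIV], rule exI[of _ "\<lambda>_. c"], rule exI[of _ "\<lambda>_. 1"])
     (auto simp: holo_on_const)

lemma meromE:
  assumes "merom f"
  obtains e g h where "e > 0" "holo_on g (ball a e)" "holo_on h (ball a e)"
    "interior {x\<in>ball a e. h x = 0} = {}" "\<forall>x\<in>ball a e. h x \<noteq> 0 \<longrightarrow> f x = g x / h x"
proof -
  obtain U g h where U: "open U" "a \<in> U" "holo_on g U" "holo_on h U"
    "interior {x\<in>U. h x = 0} = {}" "\<forall>x\<in>U. h x \<noteq> 0 \<longrightarrow> f x = g x / h x"
    using assms unfolding merom_def by meson
  obtain e where e: "e > 0" "ball a e \<subseteq> U" using U openE by blast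
  have "interior {x\<in>ball a e. h x = 0} \<subseteq> interior {x\<in>U. h x = 0}"
    by (rule interior_mono) (use e in auto)
  then show ?thesis
    using that[of e g h] e U holo_on_subset[OF _ e(2)] by auto
qed

lemma meromI:
  assumes "\<And>a. \<exists>e g h. e > 0 \<and> holo_on g (ball a e) \<and> holo_on h (ball a e) \<and>
    interior {x\<in>ball a e. h x = 0} = {} \<and> (\<forall>x\<in>ball a e. h x \<noteq> 0 \<longrightarrow> f x = g x / h x)"
  shows "merom f"
  unfolding merom_def
proof
  fix a
  obtain e g h where "e > 0" "holo_on g (ball a e)" "holo_on h (ball a e)"
    "interior {x\<in>ball a e. h x = 0} = {}" "\<forall>x\<in>ball a e. h x \<noteq> 0 \<longrightarrow> f x = g x / h x"
    using assms[of a] by blast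
  then show "\<exists>U g h. open U \<and> a \<in> U \<and> holo_on g U \<and> holo_on h U \<and>
        interior {x\<in>U. h x = 0} = {} \<and> (\<forall>x\<in>U. h x \<noteq> 0 \<longrightarrow> f x = g x / h x)"
    by - (rule exI[of _ "ball a e"], rule exI[of _ g], rule exI[of _ h], simp)
qed

lemma merom_ball2:
  assumes "merom f" "merom f'"
  obtains e g h g' h' where "e > 0" "holo_on g (ball a e)" "holo_on h (ball a e)"
    "holo_on g' (ball a e)" "holo_on h' (ball a e)"
    "interior {x\<in>ball a e. h x * h' x = 0} = {}"
    "\<And>x. x \<in> ball a e \<Longrightarrow> h x \<noteq> 0 \<Longrightarrow> f x = g x / h x"
    "\<And>x. x \<in> ball a e \<Longrightarrow> h' x \<noteq> 0 \<Longrightarrow> f' x = g' x / h' x"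
proof -
  obtain e g h where 1: "e > 0" "holo_on g (ball a e)" "holo_on h (ball a e)"
    "interior {x\<in>ball a e. h x = 0} = {}" "\<forall>x\<in>ball a e. h x \<noteq> 0 \<longrightarrow> f x = g x / h x"
    using meromE[OF assms(1), of a] by blast
  obtain e' g' h' where 2: "e' > 0" "holo_on g' (ball a e')" "holo_on h' (ball a e')"
    "interior {x\<in>ball a e'. h' x = 0} = {}" "\<forall>x\<in>ball a e'. h' x \<noteq> 0 \<longrightarrow> f' x = g' x / h' x"
    using meromE[OF assms(2), of a] by blast
  define d where "d = min e e'"
  have d: "d > 0" "ball a d \<subseteq> ball a e" "ball a d \<subseteq> ball a e'"
    using 1(1) 2(1) unfolding d_def by auto
  have "interior {x\<in>ball a d. h x = 0} \<subseteq> interior {x\<in>ball a e. h x = 0}"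
       "interior {x\<in>ball a d. h' x = 0} \<subseteq> interior {x\<in>ball a e'. h' x = 0}"
    by (rule interior_mono; use d in auto)+
  then have "interior {x\<in>ball a d. h x * h' x = 0} = {}"
    using interior_zeros_mult[of "ball a d" h h'] 1 2
      holo_on_imp_continuous_on[OF holo_on_subset[OF 1(3) d(2)]] by auto
  then show ?thesis
    using that[of d g h g' h'] d(1) 1 2 holo_on_subset[OF _ d(2)] holo_on_subset[OF _ d(3)]
      subsetD[OF d(2)] subsetD[OF d(3)] by blast
qed

lemma merom_add:
  assumes "merom f" "merom f'" shows "merom (\<lambda>x. f x + f' x)"
proof (rule meromI)
  fix a
  obtain e g h g' h' where *: "e > 0" "holo_on g (ball a e)" "holo_on h (ball a e)"
    "holo_on g' (ball a e)" "holo_on h' (ball a e)"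
    "interior {x\<in>ball a e. h x * h' x = 0} = {}"
    "\<And>x. x \<in> ball a e \<Longrightarrow> h x \<noteq> 0 \<Longrightarrow> f x = g x / h x"
    "\<And>x. x \<in> ball a e \<Longrightarrow> h' x \<noteq> 0 \<Longrightarrow> f' x = g' x / h' x"
    using merom_ball2[OF assms, of a] by blast
  show "\<exists>e g h. e > 0 \<and> holo_on g (ball a e) \<and> holo_on h (ball a e) \<and>
    interior {x\<in>ball a e. h x = 0} = {} \<and> (\<forall>x\<in>ball a e. h x \<noteq> 0 \<longrightarrow> f x + f' x = g x / h x)"
  proof (rule exI[of _ e], rule exI[of _ "\<lambda>x. g x * h' x + g' x * h x"],
      rule exI[of _ "\<lambda>x. h x * h' x"], intro conjI ballI impI)
    fix x assume "x \<in> ball a e" "h x * h' x \<noteq> 0"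
    then have "f x = g x / h x" "f' x = g' x / h' x" "h x \<noteq> 0" "h' x \<noteq> 0" using * by auto
    then show "f x + f' x = (g x * h' x + g' x * h x) / (h x * h' x)"
      by (simp add: add_frac_eq)
  qed (use * in \<open>simp_all add: holo_on_add holo_on_mult\<close>)
qed

lemma merom_mult:
  assumes "merom f" "merom f'" shows "merom (\<lambda>x. f x * f' x)"
proof (rule meromI)
  fix a
  obtain e g h g' h' where *: "e > 0" "holo_on g (ball a e)" "holo_on h (ball a e)"
    "holo_on g' (ball a e)" "holo_on h' (ball a e)"
    "interior {x\<in>ball a e. h x * h' x = 0} = {}"
    "\<And>x. x \<in> ball a e \<Longrightarrow> h x \<noteq> 0 \<Longrightarrow> f x = g x / h x"
    "\<And>x. x \<in> ball a e \<Longrightarrow> h' x \<noteq> 0 \<Longrightarrow> f' x = g' x / h' x"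
    using merom_ball2[OF assms, of a] by blast
  show "\<exists>e g h. e > 0 \<and> holo_on g (ball a e) \<and> holo_on h (ball a e) \<and>
    interior {x\<in>ball a e. h x = 0} = {} \<and> (\<forall>x\<in>ball a e. h x \<noteq> 0 \<longrightarrow> f x * f' x = g x / h x)"
  proof (rule exI[of _ e], rule exI[of _ "\<lambda>x. g x * g' x"],
      rule exI[of _ "\<lambda>x. h x * h' x"], intro conjI ballI impI)
    fix x assume "x \<in> ball a e" "h x * h' x \<noteq> 0"
    then have "f x = g x / h x" "f' x = g' x / h' x" "h x \<noteq> 0" "h' x \<noteq> 0" using * by auto
    then show "f x * f' x = (g x * g' x) / (h x * h' x)"
      by simp
  qed (use * in \<open>simp_all add: holo_on_add holo_on_mult\<close>)
qed

lemma merom_uminus: "merom f \<Longrightarrow> merom (\<lambda>x. - f x)"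
  using merom_mult[OF merom_const[of "-1"], of f] by simp

lemma merom_diff: "merom f \<Longrightarrow> merom g \<Longrightarrow> merom (\<lambda>x. f x - g x)"
  using merom_add[OF _ merom_uminus, of f g] by simp

lemma holo_on_identity:
  fixes g :: "complex^'n::finite \<Rightarrow> complex"
  assumes "holo_on g (ball a e)" "interior {x\<in>ball a e. g x = 0} \<noteq> {}" "y \<in> ball a e"
  shows "g y = 0"
proof -
  obtain v d where v: "d > 0" "ball v d \<subseteq> {x\<in>ball a e. g x = 0}"
    using assms(2) unfolding mem_interior ex_in_conv[symmetric] by blast
  then have va: "v \<in> ball a e" using centre_in_ball[of v d] by blast
  define l where "l = (\<lambda>t::complex. v + t *s (y - v))"
  define S where "S = l -` ball a e"
  have l_affine: "l ((1 - of_real r) * s + of_real r * t) = (1 - r) *\<^sub>R l s + r *\<^sub>R l t" for r s t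
    unfolding l_def vec_eq_iff
    by (simp add: vector_scalar_mult_def) (simp add: algebra_simps scaleR_conv_of_real)
  have l_deriv: "(l has_derivative (\<lambda>t. t *s (y - v))) (at t)" for t
    unfolding l_def
  proof -
    have "bounded_linear (\<lambda>t::complex. t *s (y - v))"
      by (rule linear_conv_bounded_linear[THEN iffD1], rule linearI)
         (auto simp: vec_eq_iff algebra_simps)
    from has_derivative_add[OF has_derivative_const[of v]
        bounded_linear.has_derivative[OF this has_derivative_ident]]
    show "((\<lambda>t. v + t *s (y - v)) has_derivative (\<lambda>t. t *s (y - v))) (at t)"
      by simp
  qed
  have lcont: "continuous_on UNIV l"
    by (meson continuous_at_imp_continuous_on has_derivative_continuous l_deriv)
  have opS: "open S" unfolding S_def
    using lcont by (auto intro: open_vimage)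
  have cvS: "convex S"
  proof (rule convexI)
    fix s t :: complex and u r :: real
    assume "s \<in> S" "t \<in> S" "0 \<le> u" "0 \<le> r" "u + r = 1"
    then have "u *\<^sub>R l s + r *\<^sub>R l t \<in> ball a e"
      unfolding S_def using convexD[OF convex_ball] by blast
    moreover have "u = 1 - r" using \<open>u + r = 1\<close> by simp
    ultimately show "u *\<^sub>R s + r *\<^sub>R t \<in> S"
      unfolding S_def using l_affine[of r s t] by (simp add: scaleR_conv_of_real)
  qed
  have hol: "(g \<circ> l) holomorphic_on S"
  proof (rule holomorphic_onI)
    fix t assume t: "t \<in> S"
    then have "l t \<in> ball a e" unfolding S_def by simp
    then obtain D where D: "(g has_derivative D) (at (l t))" "\<forall>c v. D (c *s v) = c * D v"
      using assms(1) unfolding holo_on_def by meson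
    have "((\<lambda>x. g (l x)) has_derivative (\<lambda>s. D (s *s (y - v)))) (at t)"
      using has_derivative_compose[OF l_deriv D(1)] .
    moreover have "(\<lambda>s. D (s *s (y - v))) = (\<lambda>s. D (y - v) * s)"
      using D(2) by (metis mult.commute)
    ultimately have "((\<lambda>x. g (l x)) has_derivative (\<lambda>s. D (y - v) * s)) (at t)"
      by (simp only:)
    then have "((g \<circ> l) has_field_derivative D (y - v)) (at t)"
      unfolding has_field_derivative_def o_def by (simp add: mult_commute_abs)
    then show "(g \<circ> l) field_differentiable (at t within S)"
      using field_differentiable_at_within field_differentiable_def by blast
  qed
  define T where "T = l -` ball v d"
  have T: "open T" unfolding T_def using lcont by (auto intro: open_vimage)
  have 0: "0 \<in> T" "T \<subseteq> S" "1 \<in> S"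
    unfolding T_def S_def l_def using v assms(3) by auto
  have "(g \<circ> l) 1 = 0"
  proof (rule analytic_continuation_open[of T S "g \<circ> l" "\<lambda>_. 0"])
    show "(g \<circ> l) z = 0" if "z \<in> T" for z
      using that v unfolding T_def by auto
  qed (use T 0 opS cvS hol convex_connected in auto)
  then show ?thesis unfolding l_def by simp
qed

lemma merom_inverse:
  assumes "merom f" shows "merom (\<lambda>x. inverse (f x))"
proof (rule meromI)
  fix a
  obtain e g h where *: "e > 0" "holo_on g (ball a e)" "holo_on h (ball a e)"
    "interior {x\<in>ball a e. h x = 0} = {}" "\<forall>x\<in>ball a e. h x \<noteq> 0 \<longrightarrow> f x = g x / h x"
    using meromE[OF assms, of a] by blast
  show "\<exists>e g h. e > 0 \<and> holo_on g (ball a e) \<and> holo_on h (ball a e) \<and>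
    interior {x\<in>ball a e. h x = 0} = {} \<and> (\<forall>x\<in>ball a e. h x \<noteq> 0 \<longrightarrow> inverse (f x) = g x / h x)"
  proof (cases "interior {x\<in>ball a e. g x = 0} = {}")
    case True
    have "interior {x\<in>ball a e. g x * h x = 0} = {}"
      by (rule interior_zeros_mult) (use * True holo_on_imp_continuous_on in auto)
    then show ?thesis using *
      by - (rule exI[of _ e], rule exI[of _ "\<lambda>x. h x * h x"], rule exI[of _ "\<lambda>x. g x * h x"],
         auto intro!: holo_on_mult)
  next
    case False
    have "f x = 0" if "x \<in> ball a e" "h x \<noteq> 0" for x
      using holo_on_identity[OF *(2) False that(1)] *(5) that by simp
    then show ?thesis using *
      by - (rule exI[of _ e], rule exI[of _ "\<lambda>x. 0"], rule exI[of _ h],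
         auto simp: holo_on_const)
  qed
qed

lemma merom_zero_or_nonzero:
  fixes f :: "complex^'n::finite \<Rightarrow> complex"
  assumes "merom f"
  shows "agree f (\<lambda>_. 0) \<or> agree (\<lambda>x. f x * inverse (f x)) (\<lambda>_. 1)"
proof -
  define Z where "Z = interior {x. f x = 0}"
  define M where "M = interior {x. f x \<noteq> 0}"
  have ZM: "open Z" "open M" "Z \<inter> M = {}"
    unfolding Z_def M_def
    using interior_subset[of "{x. f x = 0}"] interior_subset[of "{x. f x \<noteq> 0}"] by auto
  have dense: "ball a e \<subseteq> closure X"
    if X: "{x\<in>ball a e. k x \<noteq> 0} \<subseteq> X" and k: "interior {x\<in>ball a e. k x = 0} = {}"
    for a e X and k :: "complex^'n \<Rightarrow> complex"
  proof (rule ccontr)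
    assume "\<not> ?thesis"
    then have "ball a e - closure X \<noteq> {}" by auto
    moreover have "open (ball a e - closure X)" by (simp add: open_Diff)
    moreover have "ball a e - closure X \<subseteq> {x\<in>ball a e. k x = 0}"
      using X closure_subset[of X] by auto
    ultimately show False using k interior_maximal by blast
  qed
  have loc: "\<exists>e>0. ball a e \<subseteq> closure Z \<or> ball a e \<subseteq> closure M" for a
  proof -
    obtain e g h where *: "e > 0" "holo_on g (ball a e)" "holo_on h (ball a e)"
      "interior {x\<in>ball a e. h x = 0} = {}" "\<forall>x\<in>ball a e. h x \<noteq> 0 \<longrightarrow> f x = g x / h x"
      using meromE[OF assms, of a] by blast
    have op: "open {x\<in>ball a e. k x \<noteq> 0}" if "holo_on k (ball a e)" for k
    proof -
      have "open (ball a e \<inter> k -` (- {0}))"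
        by (rule continuous_open_preimage) (use holo_on_imp_continuous_on[OF that] in auto)
      then show ?thesis by (simp add: Int_def vimage_def)
    qed
    show ?thesis
    proof (cases "interior {x\<in>ball a e. g x = 0} = {}")
      case True
      have i: "interior {x\<in>ball a e. g x * h x = 0} = {}"
        by (rule interior_zeros_mult) (use * True holo_on_imp_continuous_on in auto)
      have "{x\<in>ball a e. g x * h x \<noteq> 0} \<subseteq> M" unfolding M_def
        by (rule interior_maximal) (use *(5) op[OF holo_on_mult[OF *(2,3)]] in auto)
      then show ?thesis using dense[OF _ i] *(1) by blast
    next
      case False
      have "f x = 0" if "x \<in> ball a e" "h x \<noteq> 0" for x
        using holo_on_identity[OF *(2) False that(1)] *(5) that by simp
      then have "{x\<in>ball a e. h x \<noteq> 0} \<subseteq> Z" unfolding Z_def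
        by (intro interior_maximal) (use op[OF *(3)] in auto)
      then show ?thesis using dense[OF _ *(4)] *(1) by blast
    qed
  qed
  have cover: "interior (closure Z) \<union> interior (closure M) = UNIV"
    using loc by (auto simp: mem_interior) blast
  have disj: "interior (closure Z) \<inter> interior (closure M) = {}"
  proof (rule ccontr)
    define W where "W = interior (closure Z) \<inter> interior (closure M)"
    assume "interior (closure Z) \<inter> interior (closure M) \<noteq> {}"
    then obtain x where x: "x \<in> W" unfolding W_def by blast
    have W: "open W" "W \<subseteq> closure Z" "W \<subseteq> closure M"
      unfolding W_def using interior_subset by auto
    have "x \<in> W \<inter> closure Z" using x W by auto
    then have "W \<inter> Z \<noteq> {}" using W(1) open_Int_closure_eq_empty by blast
    moreover have "open (W \<inter> Z)" using W ZM by auto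
    ultimately have "W \<inter> Z \<inter> M \<noteq> {}"
      using W(3) open_Int_closure_eq_empty[of "W \<inter> Z" M] by blast
    then show False using ZM(3) by auto
  qed
  have "connected (UNIV :: (complex^'n) set)" by (rule connected_UNIV)
  then have "interior (closure Z) = {} \<or> interior (closure M) = {}"
    using cover disj connectedD[of UNIV "interior (closure Z)" "interior (closure M)"] by auto
  then have "closure Z = UNIV \<or> closure M = UNIV"
    using cover interior_subset by (metis Un_empty_left Un_empty_right top.extremum_uniqueI)
  then show ?thesis
  proof
    assume "closure Z = UNIV"
    then have "agree f (\<lambda>_. 0)" unfolding agree_def
      using ZM interior_subset unfolding Z_def by (intro exI[of _ Z]) (auto simp: Z_def)
    then show ?thesis ..
  next
    assume M: "closure M = UNIV"
    have "f x * inverse (f x) = 1" if "x \<in> M" for x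
      using that interior_subset[of "{x. f x \<noteq> 0}"] unfolding M_def by auto
    then show ?thesis unfolding agree_def using M ZM by blast
  qed
qed

lemma merom_shift:
  assumes "merom f" shows "merom (\<lambda>x. f (x + c))"
proof (rule meromI)
  fix a
  obtain e g h where *: "e > 0" "holo_on g (ball (a + c) e)" "holo_on h (ball (a + c) e)"
    "interior {x\<in>ball (a + c) e. h x = 0} = {}"
    "\<forall>x\<in>ball (a + c) e. h x \<noteq> 0 \<longrightarrow> f x = g x / h x"
    using meromE[OF assms, of "a + c"] by blast
  have b: "(\<lambda>x. x - c) ` ball (a + c) e = ball a e"
    using ball_translation_subtract[of "a + c" c e] by simp
  have mem: "x + c \<in> ball (a + c) e \<longleftrightarrow> x \<in> ball a e" for x
    by (simp add: dist_norm)
  have "{x\<in>ball a e. h (x + c) = 0} = (\<lambda>x. x - c) ` {x\<in>ball (a + c) e. h x = 0}"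
    using b mem by (force simp: image_iff)
  then have "interior {x\<in>ball a e. h (x + c) = 0} = {}"
    using *(4) interior_translation_subtract[of c "{x\<in>ball (a + c) e. h x = 0}"] by simp
  then show "\<exists>e g h. e > 0 \<and> holo_on g (ball a e) \<and> holo_on h (ball a e) \<and>
    interior {x\<in>ball a e. h x = 0} = {} \<and> (\<forall>x\<in>ball a e. h x \<noteq> 0 \<longrightarrow> f (x + c) = g x / h x)"
    using * holo_on_shift[OF *(2), of c] holo_on_shift[OF *(3), of c] mem unfolding b
    by - (rule exI[of _ e], rule exI[of _ "\<lambda>x. g (x + c)"], rule exI[of _ "\<lambda>x. h (x + c)"],
         auto)
qed

lemma agree_shift:
  fixes f g :: "'a::real_normed_vector \<Rightarrow> 'b"
  assumes "agree f g" shows "agree (\<lambda>x. f (x + c)) (\<lambda>x. g (x + c))"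
proof -
  obtain D where D: "open D" "closure D = UNIV" "\<forall>x\<in>D. f x = g x"
    using assms unfolding agree_def by blast
  have "open ((\<lambda>x. x - c) ` D)" using D(1) open_translation_subtract by blast
  moreover have "closure ((\<lambda>x. x - c) ` D) = UNIV"
    using D(2) closure_translation_subtract[of c D] by (simp add: surj_diff_right)
  ultimately show ?thesis unfolding agree_def
    using D(3) by (intro exI[of _ "(\<lambda>x. x - c) ` D"]) auto
qed

quotient_type (overloaded) 'n mero = "complex^'n::finite \<Rightarrow> complex" /
  partial: "\<lambda>f g. merom f \<and> merom g \<and> agree f g"
proof (rule part_equivpI)
  show "\<exists>f::complex^'n \<Rightarrow> complex. merom f \<and> merom f \<and> agree f f"
    using merom_const agree_refl by blast
  show "symp (\<lambda>f g::complex^'n \<Rightarrow> complex. merom f \<and> merom g \<and> agree f g)"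
    by (auto intro!: sympI agree_sym)
  show "transp (\<lambda>f g::complex^'n \<Rightarrow> complex. merom f \<and> merom g \<and> agree f g)"
    by (auto intro!: transpI elim: agree_trans)
qed

instantiation mero :: (finite) field
begin

lift_definition zero_mero :: "'a mero" is "\<lambda>_. 0"
  by (simp add: merom_const agree_refl)

lift_definition one_mero :: "'a mero" is "\<lambda>_. 1"
  by (simp add: merom_const agree_refl)

lift_definition plus_mero :: "'a mero \<Rightarrow> 'a mero \<Rightarrow> 'a mero" is "\<lambda>f g x. f x + g x"
  by (auto intro: merom_add agree_comb[where F = "(+)"])

lift_definition minus_mero :: "'a mero \<Rightarrow> 'a mero \<Rightarrow> 'a mero" is "\<lambda>f g x. f x - g x"
  by (auto intro: merom_diff agree_comb[where F = "(-)"])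

lift_definition uminus_mero :: "'a mero \<Rightarrow> 'a mero" is "\<lambda>f x. - f x"
  by (auto intro: merom_uminus agree_comb[where F = "\<lambda>a _. - a"])

lift_definition times_mero :: "'a mero \<Rightarrow> 'a mero \<Rightarrow> 'a mero" is "\<lambda>f g x. f x * g x"
  by (auto intro: merom_mult agree_comb[where F = "(*)"])

lift_definition inverse_mero :: "'a mero \<Rightarrow> 'a mero" is "\<lambda>f x. inverse (f x)"
  by (auto intro: merom_inverse agree_comb[where F = "\<lambda>a _. inverse a"])

definition divide_mero :: "'a mero \<Rightarrow> 'a mero \<Rightarrow> 'a mero" where
  "divide_mero f g = f * inverse g"

instance
proof
  fix a b c :: "'a mero"
  show "a * b * c = a * (b * c)"
    by transfer (auto simp: mult.assoc agree_refl intro!: merom_mult)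
  show "a * b = b * a"
    by transfer (auto simp: mult.commute agree_refl intro!: merom_mult)
  show "1 * a = a"
    by transfer (auto simp: agree_refl)
  show "a + b + c = a + (b + c)"
    by transfer (auto simp: add.assoc agree_refl intro!: merom_add)
  show "a + b = b + a"
    by transfer (auto simp: add.commute agree_refl intro!: merom_add)
  show "0 + a = a"
    by transfer (auto simp: agree_refl)
  show "- a + a = 0"
    by transfer (auto simp: agree_refl merom_const)
  show "a - b = a + - b"
    by transfer (auto simp: agree_refl intro!: merom_diff)
  show "(a + b) * c = a * c + b * c"
    by transfer (auto simp: algebra_simps agree_refl intro!: merom_add merom_mult)
  show "(0 :: 'a mero) \<noteq> 1"
  proof transfer
    have "\<not> agree (\<lambda>_::complex^'a. 0::complex) (\<lambda>_. 1)"
      unfolding agree_def by (auto simp: all_not_in_conv)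
    then show "\<not> (merom (\<lambda>_::complex^'a. 0) \<and> merom (\<lambda>_::complex^'a. 1) \<and>
        agree (\<lambda>_::complex^'a. 0::complex) (\<lambda>_. 1))" by blast
  qed
  show "a \<noteq> 0 \<Longrightarrow> inverse a * a = 1"
  proof transfer
    fix f :: "complex^'a \<Rightarrow> complex"
    assume f: "merom f \<and> merom f \<and> agree f f" "\<not> (merom f \<and> merom (\<lambda>_::complex^'a. 0) \<and> agree f (\<lambda>_. 0))"
    then have "agree (\<lambda>x. f x * inverse (f x)) (\<lambda>_. 1)"
      using merom_zero_or_nonzero merom_const by blast
    then show "merom (\<lambda>x. inverse (f x) * f x) \<and> merom (\<lambda>_::complex^'a. 1) \<and>
        agree (\<lambda>x. inverse (f x) * f x) (\<lambda>_. 1)"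
      using f(1) by (auto intro: merom_mult merom_inverse merom_const simp: mult.commute)
  qed
  show "a div b = a * inverse b" by (rule divide_mero_def)
  show "inverse (0 :: 'a mero) = 0"
    by transfer (auto simp: agree_refl merom_const)
qed

end

lift_definition mero_shift :: "complex^'n::finite \<Rightarrow> 'n mero \<Rightarrow> 'n mero" is
  "\<lambda>c f x. f (x + c)"
  by (auto intro: merom_shift agree_shift)


section \<open>Theta function and the dynamical \<open>R\<close>-matrix\<close>

definition qpoch :: "complex \<Rightarrow> complex \<Rightarrow> complex" where
  "qpoch x p = (\<Prod>n. 1 - x * p ^ n)"

definition Theta :: "complex \<Rightarrow> complex \<Rightarrow> complex" where
  "Theta p z = qpoch z p * qpoch (p / z) p * qpoch p p"

text \<open>
  The function \<open>\<theta>(z) = - z\<^sup>-\<^sup>1\<^sup>/\<^sup>2 \<Theta>\<^sub>p(z)\<close> is two-valued, so it is written in terms of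
  a logarithm \<open>u\<close> of \<open>z = e\<^sup>u\<close>, with \<open>z\<^sup>1\<^sup>/\<^sup>2 = e\<^sup>u\<^sup>/\<^sup>2\<close>. Accordingly, \<open>\<eta>\<close> below is a
  logarithm of \<open>q\<close> (needed anyway to define \<open>q\<^sup>2\<^sup>P = e\<^sup>2\<^sup>\<eta>\<^sup>P\<close>) and \<open>u\<close>, \<open>lw i\<close> are logarithms
  of the spectral parameters \<open>z\<close>, \<open>w\<^sub>i\<close>.
\<close>

definition theta :: "complex \<Rightarrow> complex \<Rightarrow> complex" where
  "theta p u = - exp (- u / 2) * Theta p (exp u)"

text \<open>
  Throughout, \<open>N = CARD('n)\<close> and \<open>e\<close> is a bijection from \<open>{1..N}\<close> to the index type, so that
  \<open>P $ e j\<close> is the dynamical variable \<open>P\<^bsub>\<epsilon>\<^sub>j\<^esub>\<close>. The following is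
  the logarithm of \<open>\<Pi>\<^sup>*\<^bsub>j,k\<^esub>\<close>.
\<close>

definition lnPi :: "(nat \<Rightarrow> 'n) \<Rightarrow> complex \<Rightarrow> complex^'n::finite \<Rightarrow> nat \<Rightarrow> nat \<Rightarrow> complex" where
  "lnPi e \<eta> P j k = 2 * \<eta> * (P $ e j - P $ e k)"

text \<open>
  \<open>Rfun e \<eta> p u i \<mu> j \<nu> P\<close> is the coefficient of \<open>E\<^bsub>ij\<^esub> \<otimes> E\<^bsub>\<mu>\<nu>\<^esub>\<close>, that is, the coefficient of
  \<open>v\<^sub>i \<otimes> v\<^sub>\<mu>\<close> in the image of \<open>v\<^sub>j \<otimes> v\<^sub>\<nu>\<close>.
\<close>

definition Rfun :: "(nat \<Rightarrow> 'n) \<Rightarrow> complex \<Rightarrow> complex \<Rightarrow> complex \<Rightarrow>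
    nat \<Rightarrow> nat \<Rightarrow> nat \<Rightarrow> nat \<Rightarrow> complex^'n::finite \<Rightarrow> complex" where
  "Rfun e \<eta> p u i \<mu> j \<nu> P =
     (if i = j \<and> \<mu> = \<nu> then
        if i = \<mu> then theta p (2 * \<eta> + u)
        else if i < \<mu> then
          theta p (2 * \<eta> + lnPi e \<eta> P i \<mu>) * theta p (- 2 * \<eta> + lnPi e \<eta> P i \<mu>) * theta p u /
          (theta p (lnPi e \<eta> P i \<mu>))\<^sup>2
        else theta p u
      else if i = \<nu> \<and> \<mu> = j then
        if i < \<mu> then
          theta p (2 * \<eta>) * theta p (u + lnPi e \<eta> P i \<mu>) / theta p (lnPi e \<eta> P i \<mu>)
        else
          theta p (2 * \<eta>) * theta p (u - lnPi e \<eta> P \<mu> i) / theta p (- lnPi e \<eta> P \<mu> i)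
      else 0)"

definition Rmat :: "(nat \<Rightarrow> 'n) \<Rightarrow> complex \<Rightarrow> complex \<Rightarrow> complex \<Rightarrow>
    nat \<Rightarrow> nat \<Rightarrow> nat \<Rightarrow> nat \<Rightarrow> 'n::finite mero" where
  "Rmat e \<eta> p u i \<mu> j \<nu> = abs_mero (Rfun e \<eta> p u i \<mu> j \<nu>)"


section \<open>Tensor product of vector representations\<close>

definition multi_indices :: "nat \<Rightarrow> nat \<Rightarrow> (nat \<Rightarrow> nat) set" where
  "multi_indices N n = {1..n} \<rightarrow>\<^sub>E {1..N}"

text \<open>A vector is the family of its coefficients with respect to the basis \<open>v\<^sub>\<mu>\<close>.\<close>

type_synonym 'n tvec = "(nat \<Rightarrow> nat) \<Rightarrow> 'n mero"

definition tensor_space :: "nat \<Rightarrow> 'n::finite tvec set" where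
  "tensor_space n = {\<phi>. \<forall>\<mu>. \<mu> \<notin> multi_indices CARD('n) n \<longrightarrow> \<phi> \<mu> = 0}"

definition vscale :: "'n::finite mero \<Rightarrow> 'n tvec \<Rightarrow> 'n tvec" where
  "vscale c \<phi> = (\<lambda>\<mu>. c * \<phi> \<mu>)"

global_interpretation tvec: vector_space "vscale :: 'n::finite mero \<Rightarrow> _"
  by unfold_locales (auto simp: vscale_def algebra_simps fun_eq_iff)

definition basis_vec :: "(nat \<Rightarrow> nat) \<Rightarrow> 'n::finite tvec" where
  "basis_vec \<mu> = (\<lambda>\<nu>. if \<nu> = \<mu> then 1 else 0)"

text \<open>
  The action of \<open>R\<^sup>(\<^sup>0\<^sup>i\<^sup>)(z/w\<^sub>i, \<Pi>\<^sup>* q\<^bsup>2 \<Sum>\<^bsub>t<i\<^esub> h\<^sup>(\<^sup>t\<^sup>)\<^esup>)\<close> on \<open>\<complex>\<^sup>N \<otimes> \<V>\<close>, the first argument of a state being the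
  auxiliary index. Multiplying \<open>\<Pi>\<^sup>*\<^bsub>j,k\<^esub>\<close> by \<open>q\<^bsup>2(\<delta>\<^bsub>\<beta>j\<^esub> - \<delta>\<^bsub>\<beta>k\<^esub>)\<^esup>\<close> for each \<open>\<beta> = \<beta>\<^sub>t\<close> is the shift of \<open>P\<close> by
  the corresponding unit vectors. The factors \<open>t < i\<close> are left unchanged by \<open>R\<^sup>(\<^sup>0\<^sup>i\<^sup>)\<close>.
\<close>

definition R0 :: "(nat \<Rightarrow> 'n) \<Rightarrow> complex \<Rightarrow> complex \<Rightarrow> (nat \<Rightarrow> complex) \<Rightarrow> complex \<Rightarrow> nat \<Rightarrow>
    (nat \<Rightarrow> 'n tvec) \<Rightarrow> (nat \<Rightarrow> 'n::finite tvec)" where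
  "R0 e \<eta> p lw u i \<Phi> = (\<lambda>a \<beta>. \<Sum>j\<in>{1..CARD('n)}. \<Sum>\<nu>\<in>{1..CARD('n)}.
     mero_shift (\<Sum>t\<in>{1..<i}. axis (e (\<beta> t)) 1) (Rmat e \<eta> p (u - lw i) a (\<beta> i) j \<nu>) *
     \<Phi> j (\<beta>(i := \<nu>)))"

primrec Rprod :: "(nat \<Rightarrow> 'n) \<Rightarrow> complex \<Rightarrow> complex \<Rightarrow> (nat \<Rightarrow> complex) \<Rightarrow> complex \<Rightarrow> nat \<Rightarrow>
    (nat \<Rightarrow> 'n tvec) \<Rightarrow> (nat \<Rightarrow> 'n::finite tvec)" where
  "Rprod e \<eta> p lw u 0 \<Phi> = \<Phi>"
| "Rprod e \<eta> p lw u (Suc i) \<Phi> = R0 e \<eta> p lw u (Suc i) (Rprod e \<eta> p lw u i \<Phi>)"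

text \<open>
  \<open>Tvec \<dots> u k l \<alpha>\<close> is \<open>T\<^bsub>kl\<^esub>(z; \<Pi>\<^sup>*) v\<^sub>\<alpha>\<close>: the component at auxiliary index \<open>k\<close> of the image of
  the tensor product of the auxiliary basis vector \<open>l\<close> with \<open>v\<^sub>\<alpha>\<close>.
\<close>

definition Tvec :: "(nat \<Rightarrow> 'n) \<Rightarrow> complex \<Rightarrow> complex \<Rightarrow> nat \<Rightarrow> (nat \<Rightarrow> complex) \<Rightarrow> complex \<Rightarrow>
    nat \<Rightarrow> nat \<Rightarrow> (nat \<Rightarrow> nat) \<Rightarrow> 'n::finite tvec" where
  "Tvec e \<eta> p n lw u k l \<alpha> = Rprod e \<eta> p lw u n (\<lambda>a. if a = l then basis_vec \<alpha> else 0) k"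

definition Lop :: "(nat \<Rightarrow> 'n) \<Rightarrow> complex \<Rightarrow> complex \<Rightarrow> nat \<Rightarrow> (nat \<Rightarrow> complex) \<Rightarrow>
    nat \<Rightarrow> nat \<Rightarrow> complex \<Rightarrow> 'n tvec \<Rightarrow> 'n::finite tvec" where
  "Lop e \<eta> p n lw k l u \<phi> = (\<Sum>\<alpha>\<in>multi_indices CARD('n) n.
     vscale (mero_shift (axis (e l) 1) (\<phi> \<alpha>)) (Tvec e \<eta> p n lw u k l \<alpha>))"

text \<open>\<open>L\<^sup>+\<^bsub>kl\<^esub>(w\<^sub>S)\<close>; the factor belonging to the least element of \<open>S\<close> acts first.\<close>

definition LopS :: "(nat \<Rightarrow> 'n) \<Rightarrow> complex \<Rightarrow> complex \<Rightarrow> nat \<Rightarrow> (nat \<Rightarrow> complex) \<Rightarrow>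
    nat \<Rightarrow> nat \<Rightarrow> nat set \<Rightarrow> 'n tvec \<Rightarrow> 'n::finite tvec" where
  "LopS e \<eta> p n lw k l S = fold (\<lambda>i. Lop e \<eta> p n lw k l (lw i)) (sorted_list_of_set S)"

definition ordered_partitions :: "nat \<Rightarrow> nat \<Rightarrow> (nat \<Rightarrow> nat set) set" where
  "ordered_partitions N n =
     {I \<in> {1..N} \<rightarrow>\<^sub>E Pow {1..n}. (\<Union>k\<in>{1..N}. I k) = {1..n} \<and> disjoint_family_on I {1..N}}"

definition zeta :: "nat \<Rightarrow> 'n::finite tvec" where
  "zeta n = basis_vec (\<lambda>i\<in>{1..n}. 1)"

definition xi :: "(nat \<Rightarrow> 'n) \<Rightarrow> complex \<Rightarrow> complex \<Rightarrow> nat \<Rightarrow> (nat \<Rightarrow> complex) \<Rightarrow>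
    (nat \<Rightarrow> nat set) \<Rightarrow> 'n::finite tvec" where
  "xi e \<eta> p n lw I =
     fold (\<lambda>k. LopS e \<eta> p n lw k (k + 1) (\<Union>m\<in>{k+1..CARD('n)}. I m)) [1..<CARD('n)] (zeta n)"

end

theory Submission
  imports Defs
begin

text \<open>
  The family \<open>\<xi>\<^sub>I\<close> is triangular with respect to the standard basis, and its diagonal coefficients
  are nonzero. Indeed, encode a partition \<open>I\<close> by the multi-index \<open>\<mu>\<close> with \<open>\<mu> i = k\<close> for \<open>i \<in> I\<^sub>k\<close>; then
  \<open>v\<^sub>\<mu>\<close> occurs in \<open>\<xi>\<^sub>I\<close>, and every other \<open>v\<^sub>\<nu>\<close> occurring in \<open>\<xi>\<^sub>I\<close> has prefix sums
  \<open>\<nu> 1 + \<dots> + \<nu> m\<close> at least as large as those of \<open>\<mu>\<close> for all \<open>m\<close>, not all of them equal.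

  A coefficient of \<open>L\<^sub>k\<^sub>,\<^sub>k\<^sub>+\<^sub>1(w\<^sub>s)\<close> is a sum over paths of the auxiliary index, which starts at \<open>k + 1\<close>,
  meets the sites \<open>1, \<dots>, n\<close> in turn and ends at \<open>k\<close>. At each site the \<open>R\<close>-matrix either keeps or exchanges
  the auxiliary index and the index of the site. The sum of the indices of the first \<open>m\<close> sites
  therefore grows by \<open>k + 1\<close> minus the current auxiliary index. At site \<open>s\<close> the spectral parameter is \<open>1\<close> and
  \<open>\<theta>(1) = 0\<close>, so that the \<open>R\<close>-matrix is a multiple of the exchange. If all indices are at most \<open>k + 1\<close>, and
  at most \<open>k\<close> from site \<open>s\<close> on, then the auxiliary index is at most \<open>k + 1\<close> throughout
  and at most \<open>k\<close> after site \<open>s\<close>: the prefix sums grow by at least \<open>0\<close> before \<open>s\<close> and by at least \<open>1\<close> from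
  \<open>s\<close> on (\<open>Rprod_support\<close>). This bound is attained everywhere by only one path, which
  keeps all indices except at \<open>s\<close>, where the auxiliary index \<open>k + 1\<close> and the site index \<open>k\<close> are exchanged. Its weight is a product
  of entries \<open>\<theta>(z)\<close>, \<open>\<theta>(q\<^sup>2z)\<close> and \<open>\<theta>(q\<^sup>2)\<close>, independent of the dynamical variables and nonzero
  for generic parameters (\<open>Rprod_lead\<close>).

  Hence every \<open>L\<close>-operator in the definition of \<open>\<xi>\<^sub>I\<close> raises the index of one site in the leading
  term from \<open>k\<close> to \<open>k + 1\<close> (\<open>has_lead_Lop\<close>). Because the sites of a block are processed in increasing order,
  the condition on the indices from site \<open>s\<close> on persists, and after all steps the leading term is \<open>v\<^sub>\<mu>\<close>
  (\<open>has_lead_xi\<close>). A triangular family with nonzero diagonal is a basis (\<open>triangular_family_basis\<close>).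

  Only the support of the remaining coefficients matters for this argument. Analysis enters in two
  places: the zeros of \<open>\<theta>\<close>, and the fact that \<open>\<theta>(\<Pi>\<^sup>*)\<close> is holomorphic and not identically zero,
  which is needed to cancel it in the exchange entry at \<open>z = 1\<close>.
\<close>

section \<open>Zeros and holomorphy of the theta function\<close>

lemma summable_qpoch:
  fixes p x :: complex
  assumes "norm p < 1"
  shows "summable (\<lambda>n. norm (x * p ^ n))"
  using assms by (simp add: norm_mult norm_power summable_mult summable_geometric)

lemma convergent_prod_qpoch:
  fixes p x :: complex
  assumes "norm p < 1"
  shows "convergent_prod (\<lambda>n. 1 - x * p ^ n)"
proof -
  have "abs_convergent_prod (\<lambda>n. 1 - x * p ^ n)"
    unfolding abs_convergent_prod_conv_summable using summable_qpoch[OF assms, of x] by simp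
  then show ?thesis by (rule abs_convergent_prod_imp_convergent_prod)
qed

text \<open>
  A convergent infinite product vanishes only if one of its factors does.
\<close>

lemma qpoch_eq_0_iff:
  assumes "norm p < 1"
  shows "qpoch x p = 0 \<longleftrightarrow> (\<exists>n. x * p ^ n = 1)"
proof -
  have "qpoch x p = 0 \<longleftrightarrow> 0 \<in> range (\<lambda>n. 1 - x * p ^ n)"
    unfolding qpoch_def
    by (rule has_prod_eq_0_iff[OF convergent_prod_has_prod[OF convergent_prod_qpoch[OF assms]]])
  also have "\<dots> \<longleftrightarrow> (\<exists>n. x * p ^ n = 1)" by (metis (no_types, lifting) eq_iff_diff_eq_0 rangeE rangeI)
  finally show ?thesis .
qed

lemma Theta_eq_0_iff:
  assumes p: "0 < norm p" "norm p < 1" and "z \<noteq> 0"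
  shows "Theta p z = 0 \<longleftrightarrow> (\<exists>m::int. z = p powi m)"
proof
  assume "Theta p z = 0"
  then consider "qpoch z p = 0" | "qpoch (p / z) p = 0" | "qpoch p p = 0"
    by (auto simp: Theta_def)
  then show "\<exists>m::int. z = p powi m"
  proof cases
    case 1
    then obtain k where "z * p ^ k = 1" by (auto simp: qpoch_eq_0_iff p)
    then have "z = p powi (- int k)"
      using p by (simp add: power_int_minus field_simps)
    then show ?thesis ..
  next
    case 2
    then obtain k where "p / z * p ^ k = 1" by (auto simp: qpoch_eq_0_iff p)
    then have "z = p powi (int (Suc k))"
      unfolding power_int_of_nat using \<open>z \<noteq> 0\<close> by (simp add: field_simps)
    then show ?thesis ..
  next
    case 3
    then obtain k where "p ^ Suc k = 1" by (auto simp: qpoch_eq_0_iff p)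
    then have "norm p ^ Suc k = 1" by (metis norm_one norm_power)
    then show ?thesis using p power_Suc_less_one[of "norm p" k] by simp
  qed
next
  assume "\<exists>m::int. z = p powi m"
  then obtain m :: int where m: "z = p powi m" ..
  show "Theta p z = 0"
  proof (cases "m \<le> 0")
    case True
    then obtain k where "m = - int k" by (metis neg_int_cases nonpos_int_cases)
    then have "z * p ^ k = 1" using m p by (simp add: power_int_minus)
    then show ?thesis using p by (auto simp: Theta_def qpoch_eq_0_iff)
  next
    case False
    then obtain k where "m = int (Suc k)" by (metis not_le pos_int_cases gr0_conv_Suc)
    then have "z = p ^ Suc k" using m by (metis power_int_of_nat)
    then have "p / z * p ^ k = 1" using p by auto
    then show ?thesis using p unfolding Theta_def qpoch_eq_0_iff[OF p(2)] by (metis mult_eq_0_iff qpoch_eq_0_iff[OF p(2)])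
  qed
qed

lemma theta_eq_0_iff:
  assumes "0 < norm p" "norm p < 1"
  shows "theta p u = 0 \<longleftrightarrow> (\<exists>m::int. exp u = p powi m)"
  using Theta_eq_0_iff[OF assms, of "exp u"] by (simp add: theta_def)

lemma qpoch_holomorphic:
  assumes "norm p < 1"
  shows "(\<lambda>x. qpoch x p) holomorphic_on UNIV"
proof (rule holomorphic_uniform_sequence[where f = "\<lambda>N x. \<Prod>n<N. 1 - x * p ^ n"])
  fix x :: complex
  let ?B = "cball x 1"
  have "uniformly_convergent_on ?B (\<lambda>N x. \<Prod>n<N. 1 - x * p ^ n)"
  proof (rule uniformly_convergent_on_prod')
    show "uniformly_convergent_on ?B (\<lambda>N y. \<Sum>n<N. norm (1 - y * p ^ n - 1))"
    proof (rule Weierstrass_m_test'_ev[where M = "\<lambda>n. norm ((norm x + 1) *\<^sub>R p ^ n)"])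
      show "\<forall>\<^sub>F n in sequentially. \<forall>y\<in>?B.
        norm (norm (1 - y * p ^ n - 1)) \<le> norm ((norm x + 1) *\<^sub>R p ^ n)"
      proof (intro always_eventually allI ballI)
        fix n y assume "y \<in> ?B"
        then have "norm y \<le> norm x + 1"
          using norm_triangle_ineq2[of y x] by (simp add: dist_norm norm_minus_commute)
        then show "norm (norm (1 - y * p ^ n - 1)) \<le> norm ((norm x + 1) *\<^sub>R p ^ n)"
          by (simp add: norm_mult mult_right_mono)
      qed
      show "summable (\<lambda>n. norm ((norm x + 1) *\<^sub>R p ^ n))"
        using summable_qpoch[OF assms, of "of_real (norm x + 1)"] by (simp add: norm_mult)
    qed
  qed (auto intro!: continuous_intros)
  then obtain g where g: "uniform_limit ?B (\<lambda>N x. \<Prod>n<N. 1 - x * p ^ n) g sequentially"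
    by (auto simp: uniformly_convergent_on_def)
  have "g y = qpoch y p" if "y \<in> ?B" for y
  proof (rule LIMSEQ_unique)
    show "(\<lambda>N. \<Prod>n<N. 1 - y * p ^ n) \<longlonglongrightarrow> g y"
      using tendsto_uniform_limitI[OF g that] .
    show "(\<lambda>N. \<Prod>n<N. 1 - y * p ^ n) \<longlonglongrightarrow> qpoch y p"
      using convergent_prod_LIMSEQ[OF convergent_prod_qpoch[OF assms, of y]]
      unfolding qpoch_def by (simp add: LIMSEQ_lessThan_iff_atMost)
  qed
  then have "uniform_limit ?B (\<lambda>N x. \<Prod>n<N. 1 - x * p ^ n) (\<lambda>x. qpoch x p) sequentially"
    using g uniform_limit_cong'[where X = ?B] by (metis (mono_tags, lifting))
  then show "\<exists>d>0. cball x d \<subseteq> UNIV \<and>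
      uniform_limit (cball x d) (\<lambda>N x. \<Prod>n<N. 1 - x * p ^ n) (\<lambda>x. qpoch x p) sequentially"
    by (intro exI[of _ 1]) auto
next
  show "(\<lambda>x. \<Prod>n<N. 1 - x * p ^ n) holomorphic_on UNIV" for N
    by (intro holomorphic_on_prod holomorphic_on_diff holomorphic_on_mult holomorphic_on_const
        holomorphic_on_ident)
qed simp

lemma theta_holomorphic:
  assumes "norm p < 1"
  shows "theta p holomorphic_on UNIV"
proof -
  have comp: "(\<lambda>x. qpoch (g x) p) holomorphic_on UNIV" if "g holomorphic_on UNIV" for g
    using holomorphic_on_compose_gen[OF that qpoch_holomorphic[OF assms]] by (simp add: o_def)
  have "(\<lambda>u. - exp (- u / 2) * (qpoch (exp u) p * qpoch (p / exp u) p * qpoch p p)) holomorphic_on UNIV"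
    by (intro holomorphic_on_mult holomorphic_on_minus comp holomorphic_on_exp holomorphic_on_const
        holomorphic_on_exp' holomorphic_on_divide holomorphic_on_ident) auto
  then show ?thesis by (simp add: theta_def[abs_def] Theta_def)
qed

section \<open>Meromorphic functions of the dynamical variables\<close>

lemma holo_on_compose_linear:
  fixes lf :: "complex^'n::finite \<Rightarrow> complex"
  assumes f: "f holomorphic_on UNIV"
    and lf: "bounded_linear lf" "\<And>c v. lf (c *s v) = c * lf v"
  shows "holo_on (\<lambda>x. f (lf x)) U"
  unfolding holo_on_def
proof
  fix x
  have "(f has_field_derivative deriv f (lf x)) (at (lf x))"
    using f holomorphic_derivI by blast
  then have "(f has_derivative (*) (deriv f (lf x))) (at (lf x))"
    by (simp add: has_field_derivative_def)
  from has_derivative_compose[OF bounded_linear.has_derivative[OF lf(1) has_derivative_ident] this]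
  show "\<exists>D. ((\<lambda>x. f (lf x)) has_derivative D) (at x) \<and> (\<forall>c v. D (c *s v) = c * D v)"
    using lf(2) by (intro exI[of _ "\<lambda>v. deriv f (lf x) * lf v"]) auto
qed

text \<open>
  The identity theorem, applied on a ball that reaches from an interior point of the zero set to \<open>x\<close>.
\<close>

lemma interior_zeros_holo:
  fixes g :: "complex^'n::finite \<Rightarrow> complex"
  assumes "holo_on g UNIV" "g x \<noteq> 0"
  shows "interior {y. g y = 0} = {}"
proof (rule ccontr)
  assume "interior {y. g y = 0} \<noteq> {}"
  then obtain v where v: "v \<in> interior {y. g y = 0}" by blast
  define r where "r = dist v x + 1"
  have r: "r > 0" using zero_le_dist[of v x] unfolding r_def by linarith
  have "open (ball v r \<inter> interior {y. g y = 0})" by (simp add: open_Int)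
  then have "ball v r \<inter> interior {y. g y = 0} \<subseteq> interior {y \<in> ball v r. g y = 0}"
    using interior_subset by (intro interior_maximal) auto
  moreover have "v \<in> ball v r \<inter> interior {y. g y = 0}"
    using v r by simp
  ultimately have "interior {y \<in> ball v r. g y = 0} \<noteq> {}" by blast
  then have "g x = 0"
    by (rule holo_on_identity[OF holo_on_subset[OF assms(1)], of v r, rotated 1])
      (auto simp: r_def)
  then show False using assms(2) by contradiction
qed

lemma abs_mero_eq:
  assumes "merom f" "merom g" "agree f g"
  shows "abs_mero f = abs_mero g"
  using Quotient3_rel_abs[OF Quotient3_mero] assms by blast

lemma abs_mero_const_eq_0_iff: "abs_mero (\<lambda>_. c) = (0 :: 'n::finite mero) \<longleftrightarrow> c = 0"
proof
  assume "abs_mero (\<lambda>_. c) = (0 :: 'n mero)"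
  then have "abs_mero (\<lambda>_. c) = (abs_mero (\<lambda>_. 0) :: 'n mero)" by (simp add: zero_mero_def)
  then have "agree (\<lambda>_::complex^'n. c) (\<lambda>_. 0)"
    using Quotient3_rel[OF Quotient3_mero, of "\<lambda>_::complex^'n. c" "\<lambda>_. 0"]
    by (simp add: merom_const agree_refl)
  then show "c = 0" unfolding agree_def by fastforce
qed (simp add: zero_mero_def)

lemma mero_shift_mero_shift: "mero_shift a (mero_shift b x) = mero_shift (a + b) x"
  by transfer (auto simp: add.assoc intro!: merom_shift agree_refl)

lemma mero_shift_0_left [simp]: "mero_shift 0 x = x"
  by transfer (auto simp: agree_refl)

text \<open>
  Shifts are invertible. The dynamical shifts in the operators below thus have no influence on which
  coefficients vanish.
\<close>

lemma mero_shift_eq_0_iff [simp]: "mero_shift c x = 0 \<longleftrightarrow> x = 0"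
proof -
  have z: "mero_shift c' 0 = (0 :: 'a mero)" for c'
    by transfer (auto simp: agree_refl merom_const)
  show ?thesis
  proof
    assume "mero_shift c x = 0"
    then have "mero_shift (- c) (mero_shift c x) = 0" by (simp add: z)
    then show "x = 0" by (simp add: mero_shift_mero_shift)
  qed (simp add: z)
qed

section \<open>Entries of the \<open>R\<close>-matrix\<close>

text \<open>
  The ice rule. It makes the sum of the auxiliary index and the site index a conserved quantity.
\<close>

lemma Rmat_neq_0D:
  assumes "Rmat e \<eta> p u a b j \<nu> \<noteq> 0"
  shows "a = j \<and> b = \<nu> \<or> a = \<nu> \<and> b = j"
proof (rule ccontr)
  assume "\<not> ?thesis"
  then have "(a = j \<and> b = \<nu>) = False" "(a = \<nu> \<and> b = j) = False" by blast+
  then have "Rfun e \<eta> p u a b j \<nu> = (\<lambda>_. 0)" by (intro ext) (simp only: Rfun_def if_False)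
  then show False using assms by (simp add: Rmat_def abs_mero_const_eq_0_iff)
qed

text \<open>
  At spectral parameter \<open>z = 1\<close> every entry that keeps two distinct indices carries the factor \<open>\<theta>(1) = 0\<close>.
\<close>

lemma Rmat_0_neq_0D:
  assumes p: "0 < norm p" "norm p < 1" and R: "Rmat e \<eta> p 0 a b j \<nu> \<noteq> 0"
  shows "a = \<nu> \<and> b = j"
proof (rule ccontr)
  assume neg: "\<not> ?thesis"
  have \<theta>: "theta p 0 = 0" unfolding theta_eq_0_iff[OF p] by (intro exI[of _ "0::int"]) simp
  from Rmat_neq_0D[OF R] neg have "a = j" "b = \<nu>" "a \<noteq> b" by auto
  with \<theta> have "Rfun e \<eta> p 0 a b j \<nu> = (\<lambda>_. 0)" by (intro ext) (simp add: Rfun_def)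
  then show False using R by (simp add: Rmat_def abs_mero_const_eq_0_iff)
qed

text \<open>
  The entries \<open>\<theta>(z)\<close> and \<open>\<theta>(q\<^sup>2z)\<close>. The condition \<open>b \<le> a\<close> excludes the diagonal entries that depend on
  the dynamical variables.
\<close>

lemma Rmat_diag_neq_0:
  assumes "b \<le> a" "theta p u \<noteq> 0" "theta p (2 * \<eta> + u) \<noteq> 0"
  shows "Rmat e \<eta> p u a b a b \<noteq> 0"
proof -
  have "Rfun e \<eta> p u a b a b = (\<lambda>_. if a = b then theta p (2 * \<eta> + u) else theta p u)"
    using assms(1) by (intro ext) (simp add: Rfun_def)
  then show ?thesis using assms by (simp add: Rmat_def abs_mero_const_eq_0_iff)
qed

text \<open>
  The entry is \<open>\<theta>(q\<^sup>2)\<theta>(\<Pi>\<^sup>*)/\<theta>(\<Pi>\<^sup>*)\<close>, which equals \<open>\<theta>(q\<^sup>2)\<close> as a meromorphic function because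
  \<open>\<theta>(\<Pi>\<^sup>*)\<close> does not vanish identically: it is \<open>\<theta>(q\<^sup>2)\<close> at a point with \<open>\<Pi>\<^sup>* = q\<^sup>2\<close>.
\<close>

lemma Rmat_0_swap_neq_0:
  assumes p: "0 < norm p" "norm p < 1" and \<eta>: "theta p (2 * \<eta>) \<noteq> 0"
    and ab: "a < b" "e a \<noteq> e b"
  shows "(Rmat e \<eta> p 0 a b b a :: 'n::finite mero) \<noteq> 0"
proof -
  let ?l = "\<lambda>P::complex^'n. lnPi e \<eta> P a b"
  define g where "g = (\<lambda>P. theta p (?l P))"
  define f where "f = (\<lambda>P. theta p (2 * \<eta>) * g P / g P)"
  have lin: "bounded_linear ?l"
    unfolding lnPi_def
    by (intro bounded_linear_const_mult bounded_linear_sub bounded_linear_vec_nth)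
  have holo: "holo_on g UNIV"
    unfolding g_def
    by (rule holo_on_compose_linear[OF theta_holomorphic[OF p(2)] lin])
      (simp add: lnPi_def algebra_simps)
  have "?l (axis (e a) 1) = 2 * \<eta>" using ab by (simp add: lnPi_def axis_def)
  then have "g (axis (e a) 1) \<noteq> 0" using \<eta> by (simp add: g_def)
  then have int: "interior {P. g P = 0} = {}" by (rule interior_zeros_holo[OF holo])
  have "merom f"
    unfolding merom_def f_def
    by (intro allI exI[of _ UNIV] exI[of _ "\<lambda>P. theta p (2 * \<eta>) * g P"] exI[of _ g])
      (use holo int in \<open>auto intro: holo_on_mult holo_on_const\<close>)
  moreover have "agree f (\<lambda>_. theta p (2 * \<eta>))"
    unfolding agree_def
  proof (intro exI[of _ "- {P. g P = 0}"] conjI ballI)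
    have "closed {P. g P = 0}"
      using continuous_closed_vimage[of "{0}" g] holo_on_imp_continuous_on[OF holo]
      by (simp add: vimage_def continuous_on_eq_continuous_at)
    then show "open (- {P. g P = 0})" by (simp add: open_Compl)
    show "closure (- {P. g P = 0}) = UNIV" using int by (simp add: closure_interior)
  qed (simp add: f_def)
  ultimately have "abs_mero f = abs_mero (\<lambda>_. theta p (2 * \<eta>))"
    by (intro abs_mero_eq merom_const)
  moreover have "Rfun e \<eta> p 0 a b b a = f"
    using ab by (intro ext) (simp add: Rfun_def f_def g_def)
  ultimately show ?thesis using \<eta> by (simp add: Rmat_def abs_mero_const_eq_0_iff)
qed

section \<open>Prefix sums of multi-indices\<close>

definition prefix_sum :: "(nat \<Rightarrow> nat) \<Rightarrow> nat \<Rightarrow> nat" where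
  "prefix_sum \<mu> m = (\<Sum>j\<in>{1..m}. \<mu> j)"

lemma prefix_sum_Suc [simp]: "prefix_sum \<mu> (Suc m) = prefix_sum \<mu> m + \<mu> (Suc m)"
  by (simp add: prefix_sum_def)

lemma prefix_sum_0 [simp]: "prefix_sum \<mu> 0 = 0"
  by (simp add: prefix_sum_def)

lemma prefix_sum_cong: "(\<And>j. 1 \<le> j \<Longrightarrow> j \<le> m \<Longrightarrow> \<mu> j = \<nu> j) \<Longrightarrow> prefix_sum \<mu> m = prefix_sum \<nu> m"
  by (simp add: prefix_sum_def)

lemma prefix_sum_upd_greater [simp]: "m < i \<Longrightarrow> prefix_sum (\<mu>(i := c)) m = prefix_sum \<mu> m"
  by (rule prefix_sum_cong) auto

lemma prefix_sum_upd_Suc: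
  assumes "1 \<le> s" "\<mu> s = k"
  shows "prefix_sum (\<mu>(s := Suc k)) m = prefix_sum \<mu> m + (if s \<le> m then 1 else 0)"
  using assms by (induction m) auto

lemma prefix_sum_inject:
  assumes "\<And>m. m \<le> n \<Longrightarrow> prefix_sum \<mu> m = prefix_sum \<nu> m" and "1 \<le> j" "j \<le> n"
  shows "\<mu> j = \<nu> j"
proof -
  obtain i where "j = Suc i" using \<open>1 \<le> j\<close> by (cases j) auto
  then show ?thesis using assms(1)[of i] assms(1)[of j] \<open>j \<le> n\<close> by simp
qed

lemma multi_indices_eqI:
  assumes "\<mu> \<in> multi_indices N n" "\<nu> \<in> multi_indices N n"
    and "\<And>m. m \<le> n \<Longrightarrow> prefix_sum \<mu> m = prefix_sum \<nu> m"
  shows "\<mu> = \<nu>"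
proof
  fix j
  show "\<mu> j = \<nu> j"
  proof (cases "j \<in> {1..n}")
    case True
    then show ?thesis using prefix_sum_inject[of n \<mu> \<nu> j] assms(3) by simp
  next
    case False
    then show ?thesis using assms(1,2) unfolding multi_indices_def by (metis PiE_arb)
  qed
qed

section \<open>The path of the auxiliary index\<close>

lemma R0_neq_0E:
  assumes "R0 e \<eta> p lw u i \<Phi> a \<beta> \<noteq> 0"
  obtains j \<nu> where "Rmat e \<eta> p (u - lw i) a (\<beta> i) j \<nu> \<noteq> (0 :: 'n::finite mero)"
    "\<Phi> j (\<beta>(i := \<nu>)) \<noteq> 0"
proof -
  obtain j where "(\<Sum>\<nu>\<in>{1..CARD('n)}.
     mero_shift (\<Sum>t\<in>{1..<i}. axis (e (\<beta> t)) 1) (Rmat e \<eta> p (u - lw i) a (\<beta> i) j \<nu>) *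
     \<Phi> j (\<beta>(i := \<nu>))) \<noteq> 0"
    using assms unfolding R0_def by (rule sum.not_neutral_contains_not_neutral)
  then obtain \<nu> where "mero_shift (\<Sum>t\<in>{1..<i}. axis (e (\<beta> t)) 1) (Rmat e \<eta> p (u - lw i) a (\<beta> i) j \<nu>) *
     \<Phi> j (\<beta>(i := \<nu>)) \<noteq> 0"
    by (rule sum.not_neutral_contains_not_neutral)
  then show thesis using that[of j \<nu>] by simp
qed

text \<open>
  If only one path leads to a given state, then nothing can cancel its contribution.
\<close>

lemma R0_single:
  fixes \<Phi> :: "nat \<Rightarrow> 'n::finite tvec"
  assumes "j \<in> {1..CARD('n)}" "\<nu> \<in> {1..CARD('n)}"
    and single: "\<And>j' \<nu>'. Rmat e \<eta> p (u - lw i) a (\<beta> i) j' \<nu>' \<noteq> (0 :: 'n mero) \<Longrightarrow>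
      \<Phi> j' (\<beta>(i := \<nu>')) \<noteq> 0 \<Longrightarrow>
      j' = j \<and> \<nu>' = \<nu>"
    and nz: "Rmat e \<eta> p (u - lw i) a (\<beta> i) j \<nu> \<noteq> (0 :: 'n mero)" "\<Phi> j (\<beta>(i := \<nu>)) \<noteq> 0"
  shows "R0 e \<eta> p lw u i \<Phi> a \<beta> \<noteq> 0"
proof -
  let ?t = "\<lambda>j \<nu>. mero_shift (\<Sum>t\<in>{1..<i}. axis (e (\<beta> t)) 1) (Rmat e \<eta> p (u - lw i) a (\<beta> i) j \<nu>) *
     \<Phi> j (\<beta>(i := \<nu>))"
  have z: "?t j' \<nu>' = 0" if "j' \<noteq> j \<or> \<nu>' \<noteq> \<nu>" for j' \<nu>'
    using single[of j' \<nu>'] that by fastforce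
  have "R0 e \<eta> p lw u i \<Phi> a \<beta> = (\<Sum>j'\<in>{j}. \<Sum>\<nu>\<in>{1..CARD('n)}. ?t j' \<nu>)"
    unfolding R0_def
  proof (rule sum.mono_neutral_right)
    show "\<forall>j'\<in>{1..CARD('n)} - {j}. (\<Sum>\<nu>\<in>{1..CARD('n)}. ?t j' \<nu>) = 0"
      by (intro ballI sum.neutral z) blast
  qed (use assms(1) in simp_all)
  also have "\<dots> = (\<Sum>\<nu>\<in>{1..CARD('n)}. ?t j \<nu>)" by simp
  also have "\<dots> = (\<Sum>\<nu>'\<in>{\<nu>}. ?t j \<nu>')"
  proof (rule sum.mono_neutral_right)
    show "\<forall>\<nu>'\<in>{1..CARD('n)} - {\<nu>}. ?t j \<nu>' = 0"
      by (intro ballI z) blast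
  qed (use assms(2) in simp_all)
  finally show ?thesis using nz by simp
qed

lemma finite_multi_indices [simp]: "finite (multi_indices N n)"
  unfolding multi_indices_def by (rule finite_PiE) auto

lemma multi_indices_mono: "M \<le> N \<Longrightarrow> multi_indices M n \<subseteq> multi_indices N n"
  unfolding multi_indices_def by (rule PiE_mono) auto

lemma sum_tvec_apply: "(\<Sum>a\<in>A. f a) \<mu> = (\<Sum>a\<in>A. (f a :: 'n::finite tvec) \<mu>)"
  by (induction A rule: infinite_finite_induct) auto

text \<open>
  Relabelling the partitions by multi-indices puts \<open>\<xi>\<^sub>I\<close> and the standard basis on the same index set.
\<close>

definition blocks :: "nat \<Rightarrow> nat \<Rightarrow> (nat \<Rightarrow> nat) \<Rightarrow> (nat \<Rightarrow> nat set)" where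
  "blocks N n \<mu> = (\<lambda>k\<in>{1..N}. {i \<in> {1..n}. \<mu> i = k})"

text \<open>
  The condition maintained while the operators \<open>L\<^sub>k\<^sub>,\<^sub>k\<^sub>+\<^sub>1(w\<^sub>i)\<close> are applied in increasing order of \<open>i\<close>, when
  those with \<open>i \<ge> s\<close> are still to come: \<open>v\<^sub>\<gamma>\<close> is the leading term of \<open>\<phi>\<close>, and the index \<open>k + 1\<close> occurs only at
  sites before \<open>s\<close>.
\<close>

definition has_lead :: "nat \<Rightarrow> nat \<Rightarrow> nat \<Rightarrow> (nat \<Rightarrow> nat) \<Rightarrow> 'n::finite tvec \<Rightarrow> bool" where
  "has_lead n k s \<gamma> \<phi> \<longleftrightarrow> \<phi> \<gamma> \<noteq> 0 \<and>
     (\<forall>\<alpha>. \<phi> \<alpha> \<noteq> 0 \<longrightarrow> \<alpha> \<in> multi_indices (Suc k) n \<and> (\<forall>i\<in>{s..n}. \<alpha> i \<le> k) \<and>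
       (\<forall>m\<le>n. prefix_sum \<gamma> m \<le> prefix_sum \<alpha> m))"

text \<open>
  Once all sites have been passed, the first site is the next one to process for \<open>k + 1\<close>.
\<close>

lemma has_lead_Suc:
  assumes "has_lead n k (Suc n) \<gamma> \<phi>"
  shows "has_lead n (Suc k) 1 \<gamma> \<phi>"
proof -
  have "\<alpha> \<in> multi_indices (Suc (Suc k)) n \<and> (\<forall>i\<in>{1..n}. \<alpha> i \<le> Suc k)"
    if "\<alpha> \<in> multi_indices (Suc k) n" for \<alpha>
    using that multi_indices_mono[of "Suc k" "Suc (Suc k)" n]
    by (auto simp: multi_indices_def dest: PiE_mem)
  then show ?thesis using assms unfolding has_lead_def by blast
qed

text \<open>
  Genericity in the form in which it is used: the arguments of \<open>\<theta>\<close> are logarithms, so the last two assumptions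
  say that \<open>\<theta>(q\<^sup>2)\<close>, \<open>\<theta>(w\<^sub>i/w\<^sub>j)\<close> and \<open>\<theta>(q\<^sup>2w\<^sub>i/w\<^sub>j)\<close> do not vanish.
\<close>

locale generic_spectrum =
  fixes e :: "nat \<Rightarrow> 'n::finite" and \<eta> p :: complex and n :: nat and lw :: "nat \<Rightarrow> complex"
  assumes e_inj: "inj_on e {1..CARD('n)}"
    and p: "0 < norm p" "norm p < 1"
    and theta_q: "theta p (2 * \<eta>) \<noteq> 0"
    and theta_w: "\<And>i j. i \<in> {1..n} \<Longrightarrow> j \<in> {1..n} \<Longrightarrow> i \<noteq> j \<Longrightarrow>
      theta p (lw i - lw j) \<noteq> 0 \<and> theta p (2 * \<eta> + (lw i - lw j)) \<noteq> 0"
begin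

text \<open>
  The state \<open>(a, \<beta>)\<close> is reached from \<open>(k + 1, \<alpha>)\<close> after \<open>m\<close> sites. By the ice rule the index total, including
  the auxiliary one, is conserved, so the lower bounds for the prefix sums of \<open>\<beta>\<close> are upper bounds for
  the auxiliary index. Those hold since the auxiliary index is always \<open>k + 1\<close> or an index met before,
  and since at site \<open>s\<close> it is replaced by \<open>\<alpha> s \<le> k\<close> and afterwards meets only indices up to \<open>k\<close>.
\<close>

lemma Rprod_support:
  assumes \<alpha>: "\<And>i. i \<in> {1..n} \<Longrightarrow> \<alpha> i \<in> {1..Suc k}" "\<And>i. i \<in> {s..n} \<Longrightarrow> \<alpha> i \<le> k"
    and s: "1 \<le> s" and "m \<le> n"
    and nz: "Rprod e \<eta> p lw (lw s) m (\<lambda>a. if a = Suc k then basis_vec \<alpha> else 0) a \<beta> \<noteq> (0 :: 'n mero)"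
  shows "(\<forall>x. x \<notin> {1..m} \<longrightarrow> \<beta> x = \<alpha> x) \<and> (\<forall>x\<in>{1..m}. \<beta> x \<in> {1..Suc k}) \<and>
    (\<forall>x\<in>{1..m}. s < x \<longrightarrow> \<beta> x \<le> k) \<and>
    1 \<le> a \<and> a \<le> Suc k \<and> (s \<le> m \<longrightarrow> a \<le> k) \<and>
    prefix_sum \<beta> m + a = prefix_sum \<alpha> m + Suc k \<and>
    (\<forall>i\<le>m. prefix_sum \<alpha> i + (if s \<le> i then 1 else 0) \<le> prefix_sum \<beta> i)"
  using \<open>m \<le> n\<close> nz
proof (induction m arbitrary: a \<beta>)
  case 0
  then have "a = Suc k" "\<beta> = \<alpha>" by (auto simp: basis_vec_def split: if_splits)
  then show ?case using s by auto
next
  case (Suc m)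
  let ?\<Phi> = "Rprod e \<eta> p lw (lw s) m (\<lambda>a. if a = Suc k then basis_vec \<alpha> else 0)"
  from Suc.prems obtain j \<nu> where R: "Rmat e \<eta> p (lw s - lw (Suc m)) a (\<beta> (Suc m)) j \<nu> \<noteq> (0 :: 'n mero)"
    and \<Phi>: "?\<Phi> j (\<beta>(Suc m := \<nu>)) \<noteq> 0"
    by (auto elim: R0_neq_0E)
  let ?\<beta> = "\<beta>(Suc m := \<nu>)"
  have "m \<le> n" using Suc.prems(1) by simp
  note IH' = Suc.IH[OF this \<Phi>]
  have IH: "\<forall>x. x \<notin> {1..m} \<longrightarrow> ?\<beta> x = \<alpha> x" "\<forall>x\<in>{1..m}. ?\<beta> x \<in> {1..Suc k}"
    "\<forall>x\<in>{1..m}. s < x \<longrightarrow> ?\<beta> x \<le> k" "1 \<le> j" "j \<le> Suc k" "s \<le> m \<longrightarrow> j \<le> k"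
    using IH' by blast+
  have ice_m: "prefix_sum \<beta> m + j = prefix_sum \<alpha> m + Suc k"
    using IH' by (simp del: fun_upd_apply)
  have prefix_m: "prefix_sum \<alpha> i + (if s \<le> i then 1 else 0) \<le> prefix_sum \<beta> i" if "i \<le> m" for i
    using IH' that prefix_sum_upd_greater[of i "Suc m" \<beta> \<nu>] by (metis le_imp_less_Suc)
  have \<nu>: "\<nu> = \<alpha> (Suc m)" using IH(1) by (auto dest: spec[of _ "Suc m"])
  have \<nu>_le: "\<nu> \<in> {1..Suc k}" "s \<le> Suc m \<Longrightarrow> \<nu> \<le> k"
    using \<alpha> Suc.prems(1) by (auto simp: \<nu>)
  have ice: "a = j \<and> \<beta> (Suc m) = \<nu> \<or> a = \<nu> \<and> \<beta> (Suc m) = j"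
    using Rmat_neq_0D[OF R] .
  \<comment> \<open>For \<open>s = m + 1\<close> the two spectral parameters cancel, and the entry is the exchange.\<close>
  have perm: "a = \<nu>" if "Suc m = s"
  proof -
    have "Rmat e \<eta> p 0 a (\<beta> (Suc m)) j \<nu> \<noteq> (0 :: 'n mero)" using R that by simp
    then show ?thesis using Rmat_0_neq_0D[OF p] by blast
  qed
  have a_le: "1 \<le> a" "a \<le> Suc k"
    using ice \<nu>_le IH(4,5) by force+
  have a_le': "a \<le> k" if "s \<le> Suc m"
  proof (cases "Suc m = s")
    case True
    then show ?thesis using perm \<nu>_le(2) that by blast
  next
    case False
    then have "j \<le> k" using IH(6) that by simp
    then show ?thesis using ice \<nu>_le(2) that by blast
  qed
  have \<beta>_le: "\<beta> (Suc m) \<in> {1..Suc k}"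
    using ice \<nu>_le(1) IH(4,5) by force
  have \<beta>_le': "\<beta> (Suc m) \<le> k" if "s < Suc m"
  proof -
    have "\<nu> \<le> k" "j \<le> k" using \<nu>_le(2) IH(6) that by simp_all
    then show ?thesis using ice by blast
  qed
  have sum: "prefix_sum \<beta> (Suc m) + a = prefix_sum \<alpha> (Suc m) + Suc k"
    using ice_m ice \<nu> by force
  have "prefix_sum \<alpha> i + (if s \<le> i then 1 else 0) \<le> prefix_sum \<beta> i" if "i \<le> Suc m" for i
  proof (cases "i = Suc m")
    case True
    then show ?thesis using sum a_le a_le' by (cases "s \<le> Suc m") simp_all
  next
    case False
    then show ?thesis using prefix_m[of i] that le_Suc_eq by blast
  qed
  moreover have "\<beta> x = \<alpha> x" if "x \<notin> {1..Suc m}" for x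
  proof -
    have "x \<notin> {1..m}" "x \<noteq> Suc m" using that by auto
    then show ?thesis using IH(1) by (metis fun_upd_other)
  qed
  moreover have "\<beta> x \<in> {1..Suc k} \<and> (s < x \<longrightarrow> \<beta> x \<le> k)" if "x \<in> {1..Suc m}" for x
  proof (cases "x = Suc m")
    case True
    then show ?thesis using \<beta>_le \<beta>_le' by blast
  next
    case False
    then have "x \<in> {1..m}" using that by simp
    then show ?thesis using IH(2,3) False by (metis fun_upd_other)
  qed
  ultimately show ?case using a_le a_le' sum by blast
qed

text \<open>
  The extremal path: conservation of the index total determines the previous auxiliary index from the
  final state, so the coefficient is a product of single entries of the \<open>R\<close>-matrix.
\<close>

lemma Rprod_lead:
  assumes k: "1 \<le> k" "k < CARD('n)"
    and \<alpha>: "\<And>i. i \<in> {1..n} \<Longrightarrow> \<alpha> i \<in> {1..Suc k}" "\<And>i. i \<in> {s..n} \<Longrightarrow> \<alpha> i \<le> k" "\<alpha> s = k"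
    and s: "s \<in> {1..n}" and "m \<le> n"
  shows "Rprod e \<eta> p lw (lw s) m (\<lambda>a. if a = Suc k then basis_vec \<alpha> else 0)
    (if m < s then Suc k else k) (if m < s then \<alpha> else \<alpha>(s := Suc k)) \<noteq> (0 :: 'n mero)"
  using \<open>m \<le> n\<close>
proof (induction m)
  case 0
  then show ?case using s by (simp add: basis_vec_def)
next
  case (Suc m)
  let ?\<Phi> = "Rprod e \<eta> p lw (lw s) m (\<lambda>a. if a = Suc k then basis_vec \<alpha> else 0)"
  let ?a = "\<lambda>m. if m < s then Suc k else k"
  let ?\<beta> = "\<lambda>m. if m < s then \<alpha> else \<alpha>(s := Suc k)"
  have "1 \<le> s" "m \<le> n" using s Suc.prems by simp_all
  have upd: "(?\<beta> (Suc m))(Suc m := \<alpha> (Suc m)) = ?\<beta> m" using s by auto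
  have "R0 e \<eta> p lw (lw s) (Suc m) ?\<Phi> (?a (Suc m)) (?\<beta> (Suc m)) \<noteq> 0"
  proof (rule R0_single[where j = "?a m" and \<nu> = "\<alpha> (Suc m)"])
    show "?a m \<in> {1..CARD('n)}" using k by auto
    show "\<alpha> (Suc m) \<in> {1..CARD('n)}" using \<alpha>(1)[of "Suc m"] Suc.prems k by auto
    show "?\<Phi> (?a m) ((?\<beta> (Suc m))(Suc m := \<alpha> (Suc m))) \<noteq> 0"
      unfolding upd using Suc by simp
    show "Rmat e \<eta> p (lw s - lw (Suc m)) (?a (Suc m)) (?\<beta> (Suc m) (Suc m)) (?a m) (\<alpha> (Suc m)) \<noteq> (0 :: 'n mero)"
    proof (cases "Suc m = s")
      case True
      have e_neq: "e k \<noteq> e (Suc k)" using inj_onD[OF e_inj, of k "Suc k"] k by auto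
      then show ?thesis using True Rmat_0_swap_neq_0[OF p theta_q, of k "Suc k" e] e_neq \<alpha>(3) by simp
    next
      case False
      then have "?a (Suc m) = ?a m" "?\<beta> (Suc m) (Suc m) = \<alpha> (Suc m)" by auto
      moreover have "\<alpha> (Suc m) \<le> ?a m" using \<alpha>(1)[of "Suc m"] \<alpha>(2)[of "Suc m"] Suc.prems by auto
      ultimately show ?thesis
        using Rmat_diag_neq_0[of "\<alpha> (Suc m)" "?a m" p "lw s - lw (Suc m)" \<eta> e] theta_w[OF s, of "Suc m"] Suc.prems False
        by auto
    qed
    fix j \<nu>
    assume "?\<Phi> j ((?\<beta> (Suc m))(Suc m := \<nu>)) \<noteq> 0"
    note support = Rprod_support[OF \<alpha>(1,2) \<open>1 \<le> s\<close> \<open>m \<le> n\<close> this]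
    have "Suc m \<notin> {1..m}" by simp
    then have "((?\<beta> (Suc m))(Suc m := \<nu>)) (Suc m) = \<alpha> (Suc m)"
      using support by blast
    moreover have "prefix_sum ((?\<beta> (Suc m))(Suc m := \<nu>)) m + j = prefix_sum \<alpha> m + Suc k"
      using support by blast
    ultimately have "\<nu> = \<alpha> (Suc m)" "prefix_sum (?\<beta> (Suc m)) m + j = prefix_sum \<alpha> m + Suc k"
      by (simp_all only: fun_upd_same prefix_sum_upd_greater lessI)
    then show "j = ?a m \<and> \<nu> = \<alpha> (Suc m)"
      using prefix_sum_upd_Suc[of s \<alpha> k m, OF _ \<alpha>(3)] s by (cases "m < s") (simp_all split: if_splits)
  qed
  then show ?case by simp
qed


section \<open>Leading terms of the vectors \<open>\<xi>\<^sub>I\<close>\<close>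

lemma Lop_neq_0E:
  assumes "Lop e \<eta> p n lw k l u \<phi> \<beta> \<noteq> 0"
  obtains \<alpha> where "\<alpha> \<in> multi_indices CARD('n) n" "\<phi> \<alpha> \<noteq> 0" "Tvec e \<eta> p n lw u k l \<alpha> \<beta> \<noteq> 0"
proof -
  have "(\<Sum>\<alpha>\<in>multi_indices CARD('n) n.
     mero_shift (axis (e l) 1) (\<phi> \<alpha>) * Tvec e \<eta> p n lw u k l \<alpha> \<beta>) \<noteq> 0"
    using assms by (simp add: Lop_def vscale_def sum_tvec_apply)
  then obtain \<alpha> where "\<alpha> \<in> multi_indices CARD('n) n"
    "mero_shift (axis (e l) 1) (\<phi> \<alpha>) * Tvec e \<eta> p n lw u k l \<alpha> \<beta> \<noteq> 0"
    by (rule sum.not_neutral_contains_not_neutral)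
  then show thesis using that[of \<alpha>] by simp
qed

text \<open>
  Applied to a basis vector in the support of \<open>\<phi>\<close>, the operator increases the prefix sums at least as much as
  the step from \<open>\<gamma>\<close> to \<open>\<gamma>(s := k + 1)\<close> does. Equality in all of them forces that basis vector to be
  \<open>v\<^sub>\<gamma>\<close>, so the new leading coefficient receives the contribution of \<open>v\<^sub>\<gamma>\<close> only.
\<close>

lemma has_lead_Lop:
  assumes lead: "has_lead n k s \<gamma> \<phi>" and k: "1 \<le> k" "k < CARD('n)"
    and s: "s \<in> {1..n}" and \<gamma>: "\<gamma> s = k"
  shows "has_lead n k (Suc s) (\<gamma>(s := Suc k)) (Lop e \<eta> p n lw k (Suc k) (lw s) \<phi>)"
proof -
  let ?L = "Lop e \<eta> p n lw k (Suc k) (lw s) \<phi>"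
  let ?T = "\<lambda>\<alpha>. Tvec e \<eta> p n lw (lw s) k (Suc k) \<alpha>"
  have \<phi>: "\<phi> \<gamma> \<noteq> 0" using lead by (simp add: has_lead_def)
  have MI: "\<alpha> \<in> multi_indices (Suc k) n" "\<And>i. i \<in> {1..n} \<Longrightarrow> \<alpha> i \<in> {1..Suc k}"
    "\<And>i. i \<in> {s..n} \<Longrightarrow> \<alpha> i \<le> k" "\<And>m. m \<le> n \<Longrightarrow> prefix_sum \<gamma> m \<le> prefix_sum \<alpha> m"
    if "\<phi> \<alpha> \<noteq> 0" for \<alpha>
    using lead that unfolding has_lead_def multi_indices_def by blast+
  have prefix_\<gamma>: "prefix_sum (\<gamma>(s := Suc k)) m = prefix_sum \<gamma> m + (if s \<le> m then 1 else 0)" for m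
    using prefix_sum_upd_Suc[of s \<gamma> k m] s \<gamma> by simp
  have supp: "\<beta> \<in> multi_indices (Suc k) n" "\<forall>i\<in>{Suc s..n}. \<beta> i \<le> k"
    "\<forall>m\<le>n. prefix_sum \<alpha> m + (if s \<le> m then 1 else 0) \<le> prefix_sum \<beta> m"
    if "\<phi> \<alpha> \<noteq> 0" "?T \<alpha> \<beta> \<noteq> 0" for \<alpha> \<beta>
  proof -
    note * = Rprod_support[OF MI(2,3)[OF that(1)] _ order_refl that(2)[unfolded Tvec_def]]
    have s1: "1 \<le> s" using s by simp
    have "\<forall>x. x \<notin> {1..n} \<longrightarrow> \<beta> x = undefined"
      using *[OF _ _ s1] MI(1)[OF that(1)] unfolding multi_indices_def by (metis PiE_arb)
    moreover have "\<forall>x\<in>{1..n}. \<beta> x \<in> {1..Suc k}" using *[OF _ _ s1] by blast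
    ultimately show "\<beta> \<in> multi_indices (Suc k) n"
      unfolding multi_indices_def by (intro PiE_I) blast+
    have "\<forall>x\<in>{1..n}. s < x \<longrightarrow> \<beta> x \<le> k" using *[OF _ _ s1] by blast
    then show "\<forall>i\<in>{Suc s..n}. \<beta> i \<le> k" by simp
    show "\<forall>m\<le>n. prefix_sum \<alpha> m + (if s \<le> m then 1 else 0) \<le> prefix_sum \<beta> m"
      using *[OF _ _ s1] by blast
  qed
  have "?L (\<gamma>(s := Suc k)) = (\<Sum>\<alpha>\<in>multi_indices CARD('n) n.
     mero_shift (axis (e (Suc k)) 1) (\<phi> \<alpha>) * ?T \<alpha> (\<gamma>(s := Suc k)))"
    by (simp add: Lop_def vscale_def sum_tvec_apply)
  also have "\<dots> = (\<Sum>\<alpha>\<in>{\<gamma>}. mero_shift (axis (e (Suc k)) 1) (\<phi> \<alpha>) * ?T \<alpha> (\<gamma>(s := Suc k)))"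
  proof (rule sum.mono_neutral_right)
    show "finite (multi_indices CARD('n) n)" by (rule finite_multi_indices)
    show "{\<gamma>} \<subseteq> multi_indices CARD('n) n"
      using MI(1)[OF \<phi>] k(2) multi_indices_mono[of "Suc k" "CARD('n)" n] by auto
    show "\<forall>\<alpha>\<in>multi_indices CARD('n) n - {\<gamma>}.
        mero_shift (axis (e (Suc k)) 1) (\<phi> \<alpha>) * ?T \<alpha> (\<gamma>(s := Suc k)) = 0"
    proof (intro ballI, rule ccontr)
      fix \<alpha> assume \<alpha>: "\<alpha> \<in> multi_indices CARD('n) n - {\<gamma>}"
        and "mero_shift (axis (e (Suc k)) 1) (\<phi> \<alpha>) * ?T \<alpha> (\<gamma>(s := Suc k)) \<noteq> 0"
      then have nz: "\<phi> \<alpha> \<noteq> 0" "?T \<alpha> (\<gamma>(s := Suc k)) \<noteq> 0" by simp_all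
      have "\<gamma> = \<alpha>"
      proof (rule multi_indices_eqI[OF MI(1)[OF \<phi>] MI(1)[OF nz(1)]])
        fix m assume "m \<le> n"
        then show "prefix_sum \<gamma> m = prefix_sum \<alpha> m"
          using supp(3)[OF nz] MI(4)[OF nz(1), of m] prefix_\<gamma>[of m] by (metis add_le_cancel_right le_antisym)
      qed
      then show False using \<alpha> by simp
    qed
  qed
  also have "\<dots> \<noteq> 0"
    using \<phi> Rprod_lead[where m = n and s = s and \<alpha> = \<gamma>, OF k MI(2,3)[OF \<phi>] \<gamma> s order_refl] s by (simp add: Tvec_def)
  finally have lead': "?L (\<gamma>(s := Suc k)) \<noteq> 0" .
  show ?thesis
    unfolding has_lead_def
  proof (intro conjI allI impI)
    fix \<beta> assume "?L \<beta> \<noteq> 0"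
    then obtain \<alpha> where nz: "\<phi> \<alpha> \<noteq> 0" "?T \<alpha> \<beta> \<noteq> 0" by (rule Lop_neq_0E)
    show "\<beta> \<in> multi_indices (Suc k) n" "\<forall>i\<in>{Suc s..n}. \<beta> i \<le> k"
      using supp(1,2)[OF nz] by blast+
    fix m assume "m \<le> n"
    then show "prefix_sum (\<gamma>(s := Suc k)) m \<le> prefix_sum \<beta> m"
      using supp(3)[OF nz] MI(4)[OF nz(1), of m] prefix_\<gamma>[of m]
      by (metis add_le_cancel_right le_trans)
  qed (fact lead')
qed

lemma has_lead_fold_Lop:
  assumes "has_lead n k s \<gamma> \<phi>" and k: "1 \<le> k" "k < CARD('n)"
    and "1 \<le> s" "sorted_wrt (<) xs" "set xs \<subseteq> {s..n}" "\<And>x. x \<in> set xs \<Longrightarrow> \<gamma> x = k"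
  shows "has_lead n k (Suc n) (\<lambda>i. if i \<in> set xs then Suc k else \<gamma> i)
    (fold (\<lambda>i. Lop e \<eta> p n lw k (Suc k) (lw i)) xs \<phi>)"
  using assms(1,4-)
proof (induction xs arbitrary: s \<gamma> \<phi>)
  case Nil
  have "has_lead n k (Suc n) \<gamma> \<phi>"
    using Nil(1) unfolding has_lead_def by simp
  then show ?case by simp
next
  case (Cons x xs)
  have x: "s \<le> x" "x \<in> {1..n}" "\<gamma> x = k" "x \<notin> set xs" using Cons.prems by auto
  have "has_lead n k x \<gamma> \<phi>"
    using Cons.prems(1) x(1) unfolding has_lead_def by simp
  then have step: "has_lead n k (Suc x) (\<gamma>(x := Suc k)) (Lop e \<eta> p n lw k (Suc k) (lw x) \<phi>)"
    using has_lead_Lop[where s = x and \<gamma> = \<gamma> and k = k] k x(2,3) by blast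
  have "has_lead n k (Suc n) (\<lambda>i. if i \<in> set xs then Suc k else (\<gamma>(x := Suc k)) i)
    (fold (\<lambda>i. Lop e \<eta> p n lw k (Suc k) (lw i)) xs (Lop e \<eta> p n lw k (Suc k) (lw x) \<phi>))"
  proof (rule Cons.IH[OF step])
    show "set xs \<subseteq> {Suc x..n}"
    proof
      fix y assume "y \<in> set xs"
      then have "x < y" "y \<le> n" using Cons.prems(3,4) by (simp, auto)
      then show "y \<in> {Suc x..n}" by simp
    qed
    show "(\<gamma>(x := Suc k)) y = k" if "y \<in> set xs" for y using Cons.prems(5)[of y] that x(4) by auto
  qed (use Cons.prems(3) in simp_all)
  moreover have "(\<lambda>i. if i \<in> set xs then Suc k else (\<gamma>(x := Suc k)) i) =
      (\<lambda>i. if i \<in> set (x # xs) then Suc k else \<gamma> i)"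
    by (rule ext) simp
  ultimately show ?case by simp
qed

text \<open>
  After the factors belonging to \<open>1, \<dots>, K - 1\<close>, the leading multi-index is \<open>\<mu>\<close> capped at \<open>K\<close>: the next factor
  raises exactly the sites with index greater than \<open>K\<close>, which make up the blocks \<open>I\<^sub>K\<^sub>+\<^sub>1, \<dots>, I\<^sub>N\<close>.
\<close>

lemma has_lead_xi:
  assumes \<mu>: "\<mu> \<in> multi_indices CARD('n) n"
  shows "has_lead n CARD('n) 1 \<mu> (xi e \<eta> p n lw (blocks CARD('n) n \<mu>))"
proof -
  let ?I = "blocks CARD('n) n \<mu>"
  let ?f = "\<lambda>k. LopS e \<eta> p n lw k (k + 1) (\<Union>m\<in>{k+1..CARD('n)}. ?I m)"
  have pos: "0 < CARD('n)" by (rule zero_less_card_finite)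
  have "has_lead n K 1 (\<lambda>i\<in>{1..n}. min (\<mu> i) K) (fold ?f [1..<K] (zeta n))"
    if "1 \<le> K" "K \<le> CARD('n)" for K
    using that
  proof (induction K rule: dec_induct)
    case base
    have "(\<lambda>i\<in>{1..n}. min (\<mu> i) 1) = (\<lambda>i\<in>{1..n}. 1)"
      by (rule restrict_ext) (use \<mu> in \<open>auto simp: multi_indices_def dest!: PiE_mem\<close>)
    then show ?case
      by (auto simp: has_lead_def zeta_def basis_vec_def multi_indices_def split: if_splits)
  next
    case (step K)
    let ?xs = "sorted_list_of_set {i \<in> {1..n}. K < \<mu> i}"
    let ?\<gamma> = "\<lambda>i\<in>{1..n}. min (\<mu> i) K"
    have K: "1 \<le> K" "K < CARD('n)" using step by simp_all
    have union: "(\<Union>m\<in>{K+1..CARD('n)}. ?I m) = {i \<in> {1..n}. K < \<mu> i}"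
      using \<mu> K by (auto simp: blocks_def multi_indices_def Suc_le_eq dest: PiE_mem)
    have fold_eq: "fold ?f [1..<Suc K] (zeta n) =
        fold (\<lambda>i. Lop e \<eta> p n lw K (Suc K) (lw i)) ?xs (fold ?f [1..<K] (zeta n))"
      using K union by (simp add: LopS_def)
    have "has_lead n K (Suc n) (\<lambda>i. if i \<in> set ?xs then Suc K else ?\<gamma> i)
        (fold ?f [1..<Suc K] (zeta n))"
      unfolding fold_eq
      by (rule has_lead_fold_Lop[OF step.IH K order_refl]) (use K in auto)
    moreover have "(\<lambda>i. if i \<in> set ?xs then Suc K else ?\<gamma> i) = (\<lambda>i\<in>{1..n}. min (\<mu> i) (Suc K))"
      by (rule ext) auto
    ultimately have "has_lead n K (Suc n) (\<lambda>i\<in>{1..n}. min (\<mu> i) (Suc K))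
        (fold ?f [1..<Suc K] (zeta n))"
      by (simp only:)
    then show ?case by (rule has_lead_Suc)
  qed
  from this[of "CARD('n)"] pos
  have "has_lead n CARD('n) 1 (\<lambda>i\<in>{1..n}. min (\<mu> i) CARD('n)) (xi e \<eta> p n lw ?I)"
    by (simp add: xi_def)
  moreover have "(\<lambda>i\<in>{1..n}. min (\<mu> i) CARD('n)) = \<mu>"
    using \<mu> by (intro ext) (auto simp: multi_indices_def PiE_iff extensional_def)
  ultimately show ?thesis by simp
qed

end

section \<open>Triangular families of vectors\<close>

text \<open>
  Independence: in a vanishing combination, a vector of least rank with nonzero coefficient is the only one
  that contributes at its diagonal position. Generation: by induction from the highest rank downwards, every standard
  basis vector is obtained from a member of the family by subtracting standard basis vectors of higher rank.
\<close>

lemma triangular_family_basis: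
  fixes x :: "(nat \<Rightarrow> nat) \<Rightarrow> 'n::finite tvec" and r :: "(nat \<Rightarrow> nat) \<Rightarrow> nat"
  assumes fin: "finite B"
    and diag: "\<And>b. b \<in> B \<Longrightarrow> x b b \<noteq> 0"
    and tri: "\<And>b c. b \<in> B \<Longrightarrow> x b c \<noteq> 0 \<Longrightarrow> c \<in> B \<and> (c = b \<or> r b < r c)"
  shows "inj_on x B" and "tvec.independent (x ` B)"
    and "tvec.span (x ` B) = {\<phi>. \<forall>c. c \<notin> B \<longrightarrow> \<phi> c = 0}"
proof -
  show inj: "inj_on x B"
  proof (rule inj_onI, rule ccontr)
    fix b c assume "b \<in> B" "c \<in> B" "x b = x c" "b \<noteq> c"
    then have "r b < r c" "r c < r b"
      using tri[of b c] tri[of c b] diag[of b] diag[of c] by metis+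
    then show False by simp
  qed
  show "tvec.independent (x ` B)"
  proof (rule tvec.independent_if_scalars_zero)
    fix f v assume "(\<Sum>v\<in>x ` B. vscale (f v) v) = 0" and v: "v \<in> x ` B"
    then have sum0: "(\<Sum>b\<in>B. vscale (f (x b)) (x b)) = 0"
      by (simp add: sum.reindex[OF inj])
    show "f v = 0"
    proof (rule ccontr)
      assume "f v \<noteq> 0"
      then obtain b where b: "b \<in> B" "f (x b) \<noteq> 0"
        and least: "\<And>c. c \<in> B \<Longrightarrow> f (x c) \<noteq> 0 \<Longrightarrow> r b \<le> r c"
        using v ex_has_least_nat[of "\<lambda>b. b \<in> B \<and> f (x b) \<noteq> 0" _ r] by blast
      have "(\<Sum>c\<in>B. f (x c) * x c b) = (\<Sum>c\<in>{b}. f (x c) * x c b)"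
      proof (rule sum.mono_neutral_right)
        show "\<forall>c\<in>B - {b}. f (x c) * x c b = 0"
        proof
          fix c assume c: "c \<in> B - {b}"
          show "f (x c) * x c b = 0"
            using tri[of c b] least[of c] c by (cases "x c b = 0") auto
        qed
      qed (use fin b in auto)
      moreover have "(\<Sum>c\<in>B. f (x c) * x c b) = 0"
        using fun_cong[OF sum0, of b] by (simp add: sum_tvec_apply vscale_def)
      ultimately show False using b diag[of b] by simp
    qed
  qed (use fin in simp)
  have expand: "\<phi> = (\<Sum>c\<in>B. vscale (\<phi> c) (basis_vec c))"
    if "\<And>c. c \<notin> B \<Longrightarrow> \<phi> c = 0" for \<phi> :: "'n tvec"
  proof
    fix d
    have "(\<Sum>c\<in>B. vscale (\<phi> c) (basis_vec c)) d = (\<Sum>c\<in>B. if c = d then \<phi> c else 0)"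
      unfolding sum_tvec_apply by (rule sum.cong) (auto simp: vscale_def basis_vec_def)
    also have "\<dots> = \<phi> d" using fin that[of d] by simp
    finally show "\<phi> d = (\<Sum>c\<in>B. vscale (\<phi> c) (basis_vec c)) d" ..
  qed
  have supp: "x b c = 0" if "b \<in> B" "c \<notin> B" for b c
    using tri[of b c] that by blast
  have basis: "basis_vec b \<in> tvec.span (x ` B)" if "b \<in> B" for b
    using that
  proof (induction "Max (r ` B) - r b" arbitrary: b rule: less_induct)
    case less
    have "vscale (x b c) (basis_vec c) \<in> tvec.span (x ` B)" if c: "c \<in> B - {b}" for c
    proof (cases "x b c = 0")
      case True
      then show ?thesis by (simp add: vscale_def zero_fun_def[symmetric] tvec.span_zero)
    next
      case False
      then have "r b < r c" using tri[of b c] less.prems c by auto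
      moreover have "r c \<le> Max (r ` B)" using c fin by simp
      ultimately have "Max (r ` B) - r c < Max (r ` B) - r b" by simp
      then show ?thesis using less.hyps[of c] c by (simp add: tvec.span_scale)
    qed
    then have rest: "(\<Sum>c\<in>B - {b}. vscale (x b c) (basis_vec c)) \<in> tvec.span (x ` B)"
      by (rule tvec.span_sum)
    have "x b = vscale (x b b) (basis_vec b) + (\<Sum>c\<in>B - {b}. vscale (x b c) (basis_vec c))"
      using expand[of "x b"] supp[OF less.prems] sum.remove[OF fin less.prems] by metis
    then have "vscale (x b b) (basis_vec b) = x b - (\<Sum>c\<in>B - {b}. vscale (x b c) (basis_vec c))"
      by (metis add_diff_cancel_right')
    also have "\<dots> \<in> tvec.span (x ` B)"
      using less.prems by (intro tvec.span_diff[OF tvec.span_base rest]) simp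
    finally have "vscale (inverse (x b b)) (vscale (x b b) (basis_vec b)) \<in> tvec.span (x ` B)"
      by (rule tvec.span_scale)
    then show ?case using diag[OF less.prems] by (simp add: tvec.scale_scale)
  qed
  show "tvec.span (x ` B) = {\<phi>. \<forall>c. c \<notin> B \<longrightarrow> \<phi> c = 0}"
  proof
    show "tvec.span (x ` B) \<subseteq> {\<phi>. \<forall>c. c \<notin> B \<longrightarrow> \<phi> c = 0}"
      by (rule tvec.span_minimal) (use supp in \<open>auto simp: tvec.subspace_def vscale_def\<close>)
    show "{\<phi>. \<forall>c. c \<notin> B \<longrightarrow> \<phi> c = 0} \<subseteq> tvec.span (x ` B)"
    proof
      fix \<phi> :: "'n tvec" assume "\<phi> \<in> {\<phi>. \<forall>c. c \<notin> B \<longrightarrow> \<phi> c = 0}"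
      then have "\<phi> = (\<Sum>c\<in>B. vscale (\<phi> c) (basis_vec c))" by (intro expand) blast
      also have "\<dots> \<in> tvec.span (x ` B)" by (intro tvec.span_sum tvec.span_scale basis)
      finally show "\<phi> \<in> tvec.span (x ` B)" .
    qed
  qed
qed

section \<open>The basis theorem\<close>

lemma blocks_image: "blocks N n ` multi_indices N n = ordered_partitions N n"
proof
  show "blocks N n ` multi_indices N n \<subseteq> ordered_partitions N n"
  proof (intro image_subsetI)
    fix \<mu> assume "\<mu> \<in> multi_indices N n"
    then have "\<mu> i \<in> {1..N}" if "i \<in> {1..n}" for i
      using that unfolding multi_indices_def by (rule PiE_mem)
    then have "(\<Union>k\<in>{1..N}. blocks N n \<mu> k) = {1..n}" by (auto simp: blocks_def)
    moreover have "disjoint_family_on (blocks N n \<mu>) {1..N}"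
      by (auto simp: disjoint_family_on_def blocks_def)
    moreover have "blocks N n \<mu> \<in> {1..N} \<rightarrow>\<^sub>E Pow {1..n}"
      unfolding blocks_def by (intro restrict_PiE_iff[THEN iffD2]) auto
    ultimately show "blocks N n \<mu> \<in> ordered_partitions N n"
      by (simp add: ordered_partitions_def)
  qed
  show "ordered_partitions N n \<subseteq> blocks N n ` multi_indices N n"
  proof
    fix I assume "I \<in> ordered_partitions N n"
    then have I: "I \<in> {1..N} \<rightarrow>\<^sub>E Pow {1..n}" "(\<Union>k\<in>{1..N}. I k) = {1..n}"
      "disjoint_family_on I {1..N}"
      by (auto simp: ordered_partitions_def)
    have "\<forall>i\<in>{1..n}. \<exists>k\<in>{1..N}. i \<in> I k" using I(2) by blast
    then obtain col where col: "\<And>i. i \<in> {1..n} \<Longrightarrow> col i \<in> {1..N} \<and> i \<in> I (col i)"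
      by (metis (no_types))
    have eq: "col i = k" if "i \<in> {1..n}" "k \<in> {1..N}" "i \<in> I k" for i k
      using disjoint_family_onD[OF I(3), of "col i" k] col[OF that(1)] that(2,3) by blast
    have "blocks N n (restrict col {1..n}) = I"
    proof (rule extensionalityI[of _ "{1..N}"])
      fix k assume k: "k \<in> {1..N}"
      then have "I k \<subseteq> {1..n}" using PiE_mem[OF I(1)] by blast
      then have "I k = {i \<in> {1..n}. col i = k}"
        using eq[OF _ k] col by blast
      then show "blocks N n (restrict col {1..n}) k = I k"
        using k by (simp add: blocks_def cong: conj_cong)
    next
      show "blocks N n (restrict col {1..n}) \<in> extensional {1..N}" by (simp add: blocks_def)
      show "I \<in> extensional {1..N}" using I(1) by (simp only: PiE_iff)
    qed
    moreover have "restrict col {1..n} \<in> multi_indices N n"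
      using col unfolding multi_indices_def by (intro restrict_PiE_iff[THEN iffD2]) blast
    ultimately show "I \<in> blocks N n ` multi_indices N n" by (metis image_eqI)
  qed
qed

theorem theorem6p3:
  fixes q p \<eta> :: complex and w lw :: "nat \<Rightarrow> complex" and n :: nat
    and e :: "nat \<Rightarrow> 'n::finite"
  assumes e: "bij_betw e {1..CARD('n)} UNIV"
    and q: "0 < norm q" "norm q < 1" and \<eta>: "exp \<eta> = q"
    and p: "0 < norm p" "norm p < 1"
    and w: "\<And>i. i \<in> {1..n} \<Longrightarrow> w i \<noteq> 0" and lw: "\<And>i. i \<in> {1..n} \<Longrightarrow> exp (lw i) = w i"
    and generic_q: "\<And>m::int. q\<^sup>2 \<noteq> p powi m"
    and generic_w: "\<And>i j (m::int). i \<in> {1..n} \<Longrightarrow> j \<in> {1..n} \<Longrightarrow> i \<noteq> j \<Longrightarrow>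
          w i / w j \<noteq> p powi m \<and> q\<^sup>2 * w i / w j \<noteq> p powi m"
  shows "inj_on (xi e \<eta> p n lw) (ordered_partitions CARD('n) n) \<and>
    tvec.independent (xi e \<eta> p n lw ` ordered_partitions CARD('n) n) \<and>
    tvec.span (xi e \<eta> p n lw ` ordered_partitions CARD('n) n) = tensor_space n"
proof -
  have exp_w: "exp (lw i - lw j) = w i / w j" if "i \<in> {1..n}" "j \<in> {1..n}" for i j
    using lw that by (simp add: exp_diff)
  have exp_2\<eta>: "exp (2 * \<eta>) = q\<^sup>2"
    using \<eta> by (simp add: exp_double)
  interpret generic_spectrum e \<eta> p n lw
  proof
    show "inj_on e {1..CARD('n)}" using e by (rule bij_betw_imp_inj_on)
    show "theta p (2 * \<eta>) \<noteq> 0" using generic_q by (simp add: theta_eq_0_iff[OF p] exp_2\<eta>)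
    fix i j assume ij: "i \<in> {1..n}" "j \<in> {1..n}" "i \<noteq> j"
    show "theta p (lw i - lw j) \<noteq> 0 \<and> theta p (2 * \<eta> + (lw i - lw j)) \<noteq> 0"
      using generic_w[OF ij] exp_w[OF ij(1,2)]
      by (simp add: theta_eq_0_iff[OF p] exp_add exp_2\<eta>)
  qed (use p in auto)
  let ?B = "multi_indices CARD('n) n"
  let ?x = "\<lambda>\<mu>. xi e \<eta> p n lw (blocks CARD('n) n \<mu>)"
  \<comment> \<open>Summing the prefix sums turns the partial order of the leading terms into a rank.\<close>
  define r where "r \<mu> = (\<Sum>m\<le>n. prefix_sum \<mu> m)" for \<mu>
  have diag: "?x \<mu> \<mu> \<noteq> 0" if "\<mu> \<in> ?B" for \<mu>
    using has_lead_xi[OF that] by (simp add: has_lead_def)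
  have tri: "\<nu> \<in> ?B \<and> (\<nu> = \<mu> \<or> r \<mu> < r \<nu>)" if \<mu>: "\<mu> \<in> ?B" and \<nu>: "?x \<mu> \<nu> \<noteq> 0" for \<mu> \<nu>
  proof -
    have *: "\<nu> \<in> multi_indices (Suc CARD('n)) n" "\<forall>i\<in>{1..n}. \<nu> i \<le> CARD('n)"
      "\<forall>m\<le>n. prefix_sum \<mu> m \<le> prefix_sum \<nu> m"
      using has_lead_xi[OF \<mu>] \<nu> unfolding has_lead_def by blast+
    have \<nu>B: "\<nu> \<in> ?B" using *(1,2) by (simp add: multi_indices_def PiE_iff)
    moreover have "r \<mu> < r \<nu>" if "\<nu> \<noteq> \<mu>"
      unfolding r_def
    proof (rule sum_strict_mono_ex1)
      show "\<exists>m\<in>{..n}. prefix_sum \<mu> m < prefix_sum \<nu> m"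
      proof (rule ccontr)
        assume "\<not> ?thesis"
        then have "prefix_sum \<mu> m = prefix_sum \<nu> m" if "m \<le> n" for m
          using *(3) that by (meson atMost_iff le_neq_implies_less)
        then show False using multi_indices_eqI[OF \<mu> \<nu>B] \<open>\<nu> \<noteq> \<mu>\<close> by blast
      qed
    qed (use *(3) in auto)
    ultimately show ?thesis by blast
  qed
  note basis = triangular_family_basis[of ?B ?x r, OF finite_multi_indices diag tri]
  have image: "?x ` ?B = xi e \<eta> p n lw ` ordered_partitions CARD('n) n"
    unfolding blocks_image[symmetric] by (simp add: image_image)
  have "inj_on (xi e \<eta> p n lw) (blocks CARD('n) n ` ?B)"
    using basis(1) by (intro inj_on_imageI) (simp add: o_def)
  then show ?thesis
    using basis(2,3) unfolding image blocks_image by (simp add: tensor_space_def)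
qed

end
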